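(* There is a singular vector $v$ in $V^{-7/2}(\mathfrak{sl}_6)$ of weight $-\frac72\Lambda_0-4\delta+\omega_2+\omega_4$. It is given explicitly by $v=(A+B+C)\mathbf 1$, where a factor written without a mode means mode $(-1)$ (that is, $x:=x(-1)$ for $x\in\mathfrak{sl}_6$), $e_{ij}:=e_{i,j}$, $f_{ij}:=f_{i,j}$, products are taken in the written order, and $A= e_{15}(-3)e_{26}+\frac52 e_{15}(-2)e_{26}(-2)-e_{16}(-3)e_{25}-\frac52 e_{16}(-2)e_{25}(-2)-e_{25}(-3)e_{16}+e_{26}(-3)e_{15}$; $B=-\frac75 e_{15}(-2)e_{16}f_{12}-\frac53 e_{15}(-2)e_{23}e_{36}-\frac53 e_{15}(-2)e_{24}e_{46}-\frac53 e_{15}(-2)e_{25}e_{56}+e_{15}(-2)e_{26}\left(-h_2-\frac13h_3+\frac13h_4+h_5\right)$ $+e_{15}e_{26}\left(-\frac25h_2(-2)+\frac2{15}h_3(-2)-\frac25h_4(-2)\right)$ $+\frac75 e_{16}(-2)e_{15}f_{12}+\frac53 e_{16}(-2)e_{23}e_{35}+\frac53 e_{16}(-2)e_{24}e_{45}+e_{16}(-2)e_{25}\left(h_2+\frac13h_3-\frac13h_4+\frac23h_5\right)+\frac53 e_{16}(-2)e_{26}f_{56}$ $+e_{16}e_{25}\left(\frac25h_2(-2)-\frac2{15}h_3(-2)+\frac25h_4(-2)\right)$ $-\frac23e_{23}(-2)e_{15}e_{36}+\frac23e_{23}(-2)e_{16}e_{35}-\frac23e_{24}(-2)e_{15}e_{46}+\frac23e_{24}(-2)e_{16}e_{45}$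 $+e_{25}(-2)e_{12}e_{26}+e_{25}(-2)e_{13}e_{36}+e_{25}(-2)e_{14}e_{46}+\frac13e_{25}(-2)e_{15}e_{56}+e_{25}(-2)e_{16}\left(h_1+h_2+\frac13h_3-\frac13h_4-\frac13h_5\right)$ $-e_{26}(-2)e_{12}e_{25}-e_{26}(-2)e_{13}e_{35}-e_{26}(-2)e_{14}e_{45}+e_{26}(-2)e_{15}\left(-h_1-h_2-\frac13h_3+\frac13h_4\right)-\frac13e_{26}(-2)e_{16}f_{56}$ $-\frac23e_{35}(-2)e_{13}e_{26}+\frac23e_{35}(-2)e_{16}e_{23}+\frac23e_{36}(-2)e_{13}e_{25}-\frac23e_{36}(-2)e_{15}e_{23}$ $+\frac23e_{45}(-2)e_{14}e_{26}-\frac23e_{45}(-2)e_{16}e_{24}-\frac23e_{46}(-2)e_{14}e_{25}+\frac23e_{46}(-2)e_{15}e_{24}$; $C=-\frac25e_{12}e_{15}e_{26}f_{12}+\frac25e_{12}e_{16}e_{25}f_{12}+\frac23e_{12}e_{23}e_{25}e_{36}-\frac23e_{12}e_{23}e_{26}e_{35}+\frac23e_{12}e_{24}e_{25}e_{46}-\frac23e_{12}e_{24}e_{26}e_{45}+\frac23e_{12}e_{25}^2e_{56}-\frac23e_{12}e_{25}e_{26}h_5-\frac23e_{12}e_{26}^2f_{56}$ $+\frac4{15}e_{13}e_{15}e_{26}f_{13}-\frac23e_{13}e_{15}e_{36}f_{12}-\frac4{15}e_{13}e_{16}e_{25}f_{13}+\frac23e_{13}e_{16}e_{35}f_{12}+2e_{13}e_{24}e_{35}e_{46}-2e_{13}e_{24}e_{36}e_{45}-\frac43e_{13}e_{25}e_{34}e_{46}+\frac23e_{13}e_{25}e_{35}e_{56}$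 $+\frac23e_{13}e_{25}e_{36}(-h_2-h_3+h_4)+\frac43e_{13}e_{26}e_{34}e_{45}+\frac23e_{13}e_{26}e_{35}(h_2+h_3-h_4-h_5)-\frac23e_{13}e_{26}e_{36}f_{56}$ $+\frac4{15}e_{14}e_{15}e_{26}f_{14}-\frac23e_{14}e_{15}e_{46}f_{12}-\frac4{15}e_{14}e_{16}e_{25}f_{14}+\frac23e_{14}e_{16}e_{45}f_{12}-2e_{14}e_{23}e_{35}e_{46}+2e_{14}e_{23}e_{36}e_{45}-\frac43e_{14}e_{25}e_{36}f_{34}+\frac23e_{14}e_{25}e_{45}e_{56}$ $+\frac23e_{14}e_{25}e_{46}(-h_2+h_3+h_4)+\frac43e_{14}e_{26}e_{35}f_{34}+\frac23e_{14}e_{26}e_{45}(h_2-h_3-h_4-h_5)-\frac23e_{14}e_{26}e_{46}f_{56}$ $+\frac4{15}e_{15}^2e_{26}f_{15}-\frac23e_{15}^2e_{56}f_{12}-\frac4{15}e_{15}e_{16}e_{25}f_{15}+\frac4{15}e_{15}e_{16}e_{26}f_{16}+\frac23e_{15}e_{16}f_{12}h_5+\frac4{15}e_{15}e_{23}e_{26}f_{23}+\frac43e_{15}e_{23}e_{34}e_{46}-\frac23e_{15}e_{23}e_{35}e_{56}$ $+\frac23e_{15}e_{23}e_{36}(h_1+h_2+h_3-h_4)+\frac4{15}e_{15}e_{24}e_{26}f_{24}+\frac43e_{15}e_{24}e_{36}f_{34}-\frac23e_{15}e_{24}e_{45}e_{56}+\frac23e_{15}e_{24}e_{46}(h_1+h_2-h_3-h_4)$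 $+\frac4{15}e_{15}e_{25}e_{26}f_{25}+\frac23e_{15}e_{25}e_{56}h_1+\frac4{15}e_{15}e_{26}e_{26}f_{26}-\frac{16}{15}e_{15}e_{26}e_{34}f_{34}+\frac4{15}e_{15}e_{26}e_{35}f_{35}+\frac4{15}e_{15}e_{26}e_{36}f_{36}+\frac4{15}e_{15}e_{26}e_{45}f_{45}+\frac4{15}e_{15}e_{26}e_{46}f_{46}-\frac25e_{15}e_{26}e_{56}f_{56}$ $+e_{15}e_{26}\left(\frac25h_1h_2+\frac2{15}h_1h_3-\frac2{15}h_1h_4-\frac25h_1h_5+\frac25h_2h_2+\frac4{15}h_2h_3-\frac4{15}h_2h_4-\frac2{15}h_2h_5-\frac2{15}h_3h_3+\frac4{15}h_3h_4+\frac2{15}h_3h_5+\frac25h_4h_4+\frac25h_4h_5\right)$ $-\frac4{15}e_{16}^2e_{25}f_{16}+\frac23e_{16}^2f_{12}f_{56}-\frac4{15}e_{16}e_{23}e_{25}f_{23}-\frac43e_{16}e_{23}e_{34}e_{45}+\frac23e_{16}e_{23}e_{35}(-h_1-h_2-h_3+h_4+h_5)+\frac23e_{16}e_{23}e_{36}f_{56}$ $-\frac4{15}e_{16}e_{24}e_{25}f_{24}-\frac43e_{16}e_{24}e_{35}f_{34}+\frac23e_{16}e_{24}e_{45}(-h_1-h_2+h_3+h_4+h_5)+\frac23e_{16}e_{24}e_{46}f_{56}$ $-\frac4{15}e_{16}e_{25}^2f_{25}-\frac4{15}e_{16}e_{25}e_{26}f_{26}+\frac{16}{15}e_{16}e_{25}e_{34}f_{34}-\frac4{15}e_{16}e_{25}e_{35}f_{35}-\frac4{15}e_{16}e_{25}e_{36}f_{36}-\frac4{15}e_{16}e_{25}e_{45}f_{45}-\frac4{15}e_{16}e_{25}e_{46}f_{46}+\frac25e_{16}e_{25}e_{56}f_{56}$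 $+e_{16}e_{25}\left(-\frac25h_1h_2-\frac2{15}h_1h_3+\frac2{15}h_1h_4-\frac4{15}h_1h_5-\frac25h_2h_2-\frac4{15}h_2h_3+\frac4{15}h_2h_4+\frac2{15}h_2h_5+\frac2{15}h_3h_3-\frac4{15}h_3h_4-\frac2{15}h_3h_5-\frac25h_4h_4-\frac25h_4h_5\right)$ $-\frac23e_{16}e_{26}f_{56}h_1$.
   Context: $V^k(\mathfrak g)$ is the universal affine vertex operator algebra of level $k$ for the simple Lie algebra $\mathfrak g$ (invariant form normalized so that the highest root has square length $2$), with vacuum vector $\mathbf 1$; $x(m)$ denotes the action of $x\otimes t^m$. For $\mathfrak{sl}_6$, $e_{i,j}$ and $f_{i,j}$ ($i<j$) are the matrix units $E_{ij}$ and $E_{ji}$, $h_i=E_{ii}-E_{i+1,i+1}$ are the simple coroots, and $\omega_1,\dots,\omega_5$ are the fundamental weights. A singular vector in $V^k(\mathfrak g)$ is a nonzero weight vector annihilated by $\mathfrak n_+\otimes t^0$ and by $\mathfrak g\otimes t\mathbb C[t]$, where $\mathfrak n_+$ is the sum of the positive root spaces; equivalently, for $\mathfrak{sl}_6$, by $e_{i,i+1}(0)$, $i=1,\dots,5$, and $f_{1,6}(1)$. Weight $-\frac72\Lambda_0-4\delta+\omega_2+\omega_4$ means conformal weight $4$ and $\mathfrak{sl}_6$-weight $\omega_2+\omega_4$. *)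

theory Defs
  imports "HOL-Analysis.Analysis" "HOL-Library.Poly_Mapping"
begin

section \<open>The Lie algebra sl(6)\<close>

text \<open>
  Rows and columns are numbered 1, ..., 6; in the index type \<^typ>\<open>6\<close> the number 6 is the
  residue 0, so the order of the type is not the order of the numbering. All indices below are
  therefore natural numbers, embedded by \<^const>\<open>of_nat\<close>.
\<close>

typedef sl6 = "{A :: complex^6^6. trace A = 0}"
  by (rule exI[of _ 0]) (simp add: trace_def)

setup_lifting type_definition_sl6

instantiation sl6 :: ab_group_add
begin

lift_definition zero_sl6 :: sl6 is 0 by (simp add: trace_def)
lift_definition plus_sl6 :: "sl6 \<Rightarrow> sl6 \<Rightarrow> sl6" is "(+)" by (simp add: trace_add)
lift_definition minus_sl6 :: "sl6 \<Rightarrow> sl6 \<Rightarrow> sl6" is "(-)" by (simp add: trace_sub)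
lift_definition uminus_sl6 :: "sl6 \<Rightarrow> sl6" is uminus by (simp add: trace_def sum_negf)

instance
  by standard (transfer; simp)+

end

lift_definition sl_scale :: "complex \<Rightarrow> sl6 \<Rightarrow> sl6" is "\<lambda>c A. \<chi> i j. c * A $ i $ j"
proof -
  fix c :: complex and A :: "complex^6^6"
  assume "trace A = 0"
  then show "trace (\<chi> i j. c * A $ i $ j) = 0"
    by (simp add: trace_def sum_distrib_left[symmetric])
qed

global_interpretation sl6: vector_space sl_scale
proof
  fix c d :: complex and x y :: sl6
  show "sl_scale c (x + y) = sl_scale c x + sl_scale c y"
    by transfer (simp add: vec_eq_iff distrib_left)
  show "sl_scale (c + d) x = sl_scale c x + sl_scale d x"
    by transfer (simp add: vec_eq_iff distrib_right)
  show "sl_scale c (sl_scale d x) = sl_scale (c * d) x"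
    by transfer (simp add: vec_eq_iff)
  show "sl_scale 1 x = x"
    by transfer (simp add: vec_eq_iff)
qed

lift_definition sl_bracket :: "sl6 \<Rightarrow> sl6 \<Rightarrow> sl6" is "\<lambda>A B. A ** B - B ** A"
  unfolding trace_sub by (subst trace_mul_sym) (rule diff_self)

text \<open>The invariant form on sl(6) for which the highest root has square length 2.\<close>

lift_definition sl_form :: "sl6 \<Rightarrow> sl6 \<Rightarrow> complex" is "\<lambda>A B. trace (A ** B)" .

definition matrix_unit :: "nat \<Rightarrow> nat \<Rightarrow> complex^6^6" where
  "matrix_unit i j = (\<chi> a b. if a = of_nat i \<and> b = of_nat j then 1 else 0)"

lemma trace_matrix_unit: "trace (matrix_unit i j) = (if (of_nat i :: 6) = of_nat j then 1 else 0)"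
proof -
  define p q :: 6 where "p = of_nat i" and "q = of_nat j"
  have "trace (matrix_unit i j) = (\<Sum>a\<in>UNIV. if a = p then (if p = q then 1 else 0) else 0)"
    unfolding trace_def matrix_unit_def p_def[symmetric] q_def[symmetric]
    by (rule sum.cong) simp_all
  also have "\<dots> = (if p = q then 1 else 0)"
    by (simp only: sum.delta[OF finite] UNIV_I if_True)
  finally show ?thesis unfolding p_def q_def .
qed

text \<open>Only used for distinct indices in 1, ..., 6; the diagonal case is a dummy value.\<close>

lift_definition sl_unit :: "nat \<Rightarrow> nat \<Rightarrow> sl6" is
  "\<lambda>i j. if (of_nat i :: 6) = of_nat j then 0 else matrix_unit i j"
  by (simp add: trace_matrix_unit) (simp add: trace_def)

lift_definition coroot :: "nat \<Rightarrow> sl6" is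
  "\<lambda>i. matrix_unit i i - matrix_unit (i + 1) (i + 1)"
  by (simp add: trace_sub trace_matrix_unit)

definition sl_nplus :: "sl6 set" where
  "sl_nplus = sl6.span {sl_unit i j | i j. 1 \<le> i \<and> i < j \<and> j \<le> 6}"

definition sl_cartan :: "sl6 set" where
  "sl_cartan = {x. \<forall>a b. a \<noteq> b \<longrightarrow> Rep_sl6 x $ a $ b = 0}"


section \<open>The affine Kac-Moody algebra\<close>

text \<open>
  A triple \<open>(p, a, b)\<close> stands for \<open>(\<Sum>m. p\<^sub>m \<otimes> t\<^sup>m) + a K + b d\<close>, with \<open>d = t d/dt\<close>.
\<close>

type_synonym affine = "(int \<Rightarrow>\<^sub>0 sl6) \<times> complex \<times> complex"

definition loop :: "sl6 \<Rightarrow> int \<Rightarrow> affine" where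
  "loop x m = (Poly_Mapping.single m x, 0, 0)"

definition central :: affine where "central = (0, 1, 0)"

definition derivation :: affine where "derivation = (0, 0, 1)"

fun affine_scale :: "complex \<Rightarrow> affine \<Rightarrow> affine" where
  "affine_scale c (p, a, b) = (Poly_Mapping.map (sl_scale c) p, c * a, c * b)"

definition loop_deriv :: "(int \<Rightarrow>\<^sub>0 sl6) \<Rightarrow> (int \<Rightarrow>\<^sub>0 sl6)" where
  "loop_deriv p = Poly_Mapping.mapp (\<lambda>m. sl_scale (of_int m)) p"

fun affine_bracket :: "affine \<Rightarrow> affine \<Rightarrow> affine" where
  "affine_bracket (p, a, b) (q, a', b') =
     ((\<Sum>m\<in>Poly_Mapping.keys p. \<Sum>n\<in>Poly_Mapping.keys q.
         Poly_Mapping.single (m + n)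
           (sl_bracket (Poly_Mapping.lookup p m) (Poly_Mapping.lookup q n)))
       + Poly_Mapping.map (sl_scale b) (loop_deriv q)
       - Poly_Mapping.map (sl_scale b') (loop_deriv p),
      (\<Sum>m\<in>Poly_Mapping.keys p.
         of_int m * sl_form (Poly_Mapping.lookup p m) (Poly_Mapping.lookup q (- m))),
      0)"

lemma sl_bracket_zero [simp]: "sl_bracket 0 x = 0" "sl_bracket x 0 = 0"
  by (transfer; simp)+

lemma sl_form_zero [simp]: "sl_form 0 x = 0" "sl_form x 0 = 0"
  by (transfer; simp add: trace_def)+

lemma loop_deriv_zero [simp]: "loop_deriv 0 = 0"
  unfolding loop_deriv_def by (rule poly_mapping_eqI) (simp add: lookup_mapp)

lemma loop_deriv_single [simp]:
  "loop_deriv (Poly_Mapping.single m x) = Poly_Mapping.single m (sl_scale (of_int m) x)"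
  unfolding loop_deriv_def
  by (rule poly_mapping_eqI) (auto simp: lookup_mapp lookup_single when_def)

lemma map_zero_poly [simp]: "Poly_Mapping.map g 0 = 0"
  by (rule poly_mapping_eqI) (simp add: Poly_Mapping.map.rep_eq)

lemma map_scale_zero [simp]: "Poly_Mapping.map (sl_scale 0) p = 0"
  by (rule poly_mapping_eqI) (simp add: Poly_Mapping.map.rep_eq)

lemma affine_bracket_loop_loop:
  "affine_bracket (loop x m) (loop y n) =
     loop (sl_bracket x y) (m + n)
       + affine_scale (if m + n = 0 then of_int m * sl_form x y else 0) central"
proof (cases "x = 0 \<or> y = 0")
  case True
  then show ?thesis by (auto simp: loop_def central_def zero_prod_def)
next
  case False
  then show ?thesis
    by (auto simp: loop_def central_def lookup_single when_def add_eq_0_iff)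
qed

lemma affine_bracket_derivation_loop:
  "affine_bracket derivation (loop x m) = affine_scale (of_int m) (loop x m)"
proof (cases "x = 0")
  case False
  then show ?thesis
    by (simp add: loop_def derivation_def map_single)
qed (simp add: loop_def derivation_def)

lemma affine_bracket_central: "affine_bracket central X = 0"
  by (cases X) (simp add: central_def zero_prod_def)


section \<open>The universal enveloping algebra\<close>

instantiation list :: (type) monoid_add
begin

definition zero_list :: "'a list" where "zero_list = []"

definition plus_list :: "'a list \<Rightarrow> 'a list \<Rightarrow> 'a list" where "plus_list = (@)"

instance
  by standard (simp_all add: zero_list_def plus_list_def)

end

text \<open>
  With concatenation as addition on lists, the convolution product of \<^typ>\<open>'a list \<Rightarrow>\<^sub>0 complex\<close>
  makes this type the free associative unital algebra on \<^typ>\<open>'a\<close>.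
\<close>

type_synonym free_algebra = "affine list \<Rightarrow>\<^sub>0 complex"

definition free_const :: "complex \<Rightarrow> free_algebra" where
  "free_const c = Poly_Mapping.single [] c"

definition free_gen :: "affine \<Rightarrow> free_algebra" where
  "free_gen X = Poly_Mapping.single [X] 1"

definition uea_relators :: "free_algebra set" where
  "uea_relators =
     {free_gen (X + Y) - free_gen X - free_gen Y | X Y. True} \<union>
     {free_gen (affine_scale c X) - free_const c * free_gen X | c X. True} \<union>
     {free_gen X * free_gen Y - free_gen Y * free_gen X - free_gen (affine_bracket X Y) | X Y. True}"

inductive_set uea_ideal :: "free_algebra set" where
  zero: "0 \<in> uea_ideal"
| relator: "r \<in> uea_relators \<Longrightarrow> r \<in> uea_ideal"
| add: "u \<in> uea_ideal \<Longrightarrow> w \<in> uea_ideal \<Longrightarrow> u + w \<in> uea_ideal"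
| left: "u \<in> uea_ideal \<Longrightarrow> w * u \<in> uea_ideal"
| right: "u \<in> uea_ideal \<Longrightarrow> u * w \<in> uea_ideal"

lemma uea_ideal_uminus: "u \<in> uea_ideal \<Longrightarrow> - u \<in> uea_ideal"
  using uea_ideal.left[of u "- 1"] by simp

lemma uea_ideal_diff: "u \<in> uea_ideal \<Longrightarrow> w \<in> uea_ideal \<Longrightarrow> u - w \<in> uea_ideal"
  using uea_ideal.add[of u "- w"] uea_ideal_uminus by simp

lemma lookup_times_empty:
  fixes p q :: free_algebra
  shows "Poly_Mapping.lookup (p * q) [] = Poly_Mapping.lookup p [] * Poly_Mapping.lookup q []"
proof -
  have "Poly_Mapping.lookup (p * q) [] =
      (\<Sum>l. Poly_Mapping.lookup p l * (\<Sum>r. Poly_Mapping.lookup q r when [] = l + r))"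
    by (simp add: lookup_mult)
  also have "\<dots> = (\<Sum>l. Poly_Mapping.lookup p l * Poly_Mapping.lookup q [] when l = [])"
    by (rule Sum_any.cong) (auto simp: plus_list_def when_def)
  finally show ?thesis by simp
qed

lemma uea_ideal_lookup_empty: "u \<in> uea_ideal \<Longrightarrow> Poly_Mapping.lookup u [] = 0"
proof (induction rule: uea_ideal.induct)
  case (relator r)
  then show ?case
    by (auto simp: uea_relators_def free_gen_def lookup_minus lookup_single lookup_times_empty)
qed (simp_all add: lookup_add lookup_times_empty)

lemma one_notin_uea_ideal: "1 \<notin> uea_ideal"
  using uea_ideal_lookup_empty[of 1] by (auto simp: lookup_one zero_list_def)

quotient_type uea = free_algebra / "\<lambda>u w. u - w \<in> uea_ideal"
proof (rule equivpI)
  show "reflp (\<lambda>u w. u - w \<in> uea_ideal)"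
    by (simp add: reflp_def uea_ideal.zero)
  show "symp (\<lambda>u w. u - w \<in> uea_ideal)"
    by (rule sympI) (use uea_ideal_uminus in force)
  show "transp (\<lambda>u w. u - w \<in> uea_ideal)"
    proof (rule transpI)
    fix u w x :: free_algebra
    assume "u - w \<in> uea_ideal" "w - x \<in> uea_ideal"
    then have "(u - w) + (w - x) \<in> uea_ideal" by (rule uea_ideal.add)
    then show "u - x \<in> uea_ideal" by simp
  qed
qed

instantiation uea :: ring_1
begin

lift_definition zero_uea :: uea is 0 .
lift_definition one_uea :: uea is 1 .

lift_definition plus_uea :: "uea \<Rightarrow> uea \<Rightarrow> uea" is "(+)"
  unfolding add_diff_add by (rule uea_ideal.add)

lift_definition uminus_uea :: "uea \<Rightarrow> uea" is uminus
  by (metis minus_diff_minus uea_ideal_uminus)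

lift_definition minus_uea :: "uea \<Rightarrow> uea \<Rightarrow> uea" is "(-)"
proof -
  fix a b c d :: free_algebra
  assume "a - b \<in> uea_ideal" "c - d \<in> uea_ideal"
  then have "(a - b) - (c - d) \<in> uea_ideal" by (rule uea_ideal_diff)
  then show "(a - c) - (b - d) \<in> uea_ideal" by (simp add: algebra_simps)
qed

lift_definition times_uea :: "uea \<Rightarrow> uea \<Rightarrow> uea" is "(*)"
proof -
  fix a b c d :: free_algebra
  assume "a - b \<in> uea_ideal" "c - d \<in> uea_ideal"
  then have "(a - b) * c + b * (c - d) \<in> uea_ideal"
    by (intro uea_ideal.add uea_ideal.left uea_ideal.right)
  then show "a * c - b * d \<in> uea_ideal" by (simp add: algebra_simps)
qed

instance
proof
  show "(0 :: uea) \<noteq> 1"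
    by transfer (use uea_ideal_uminus[of "- 1"] one_notin_uea_ideal in auto)
qed (transfer; simp add: algebra_simps uea_ideal.zero)+

end

text \<open>
  Scalar multiplication binds more weakly than the product, so that \<open>2/3 \<cdot> u * w\<close> is
  \<open>(2/3) \<cdot> (u * w)\<close>.
\<close>

lift_definition uea_scale :: "complex \<Rightarrow> uea \<Rightarrow> uea" (infixr \<open>\<cdot>\<close> 68) is
  "\<lambda>c u. free_const c * u"
  unfolding right_diff_distrib[symmetric] by (rule uea_ideal.left)

lift_definition uea_gen :: "affine \<Rightarrow> uea" is free_gen .

definition mode :: "sl6 \<Rightarrow> int \<Rightarrow> uea" where
  "mode x m = uea_gen (loop x m)"


section \<open>The universal affine vertex algebra as a module over the affine Kac-Moody algebra\<close>

text \<open>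
  \<open>V\<^sup>k\<close> is the module induced from the one-dimensional module of
  \<open>sl(6)[t] \<oplus> \<complex>K \<oplus> \<complex>d\<close> on which \<open>sl(6)[t]\<close> and \<open>d\<close> act by 0 and \<open>K\<close> acts by \<open>k\<close>. It is the
  quotient of the enveloping algebra by the following left ideal.
\<close>

inductive_set vacuum_ideal :: "complex \<Rightarrow> uea set" for k :: complex where
  zero: "0 \<in> vacuum_ideal k"
| nonneg: "0 \<le> m \<Longrightarrow> mode x m \<in> vacuum_ideal k"
| central: "uea_gen central - k \<cdot> 1 \<in> vacuum_ideal k"
| derivation: "uea_gen derivation \<in> vacuum_ideal k"
| add: "u \<in> vacuum_ideal k \<Longrightarrow> w \<in> vacuum_ideal k \<Longrightarrow> u + w \<in> vacuum_ideal k"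
| left: "u \<in> vacuum_ideal k \<Longrightarrow> w * u \<in> vacuum_ideal k"

lemma vacuum_ideal_uminus: "u \<in> vacuum_ideal k \<Longrightarrow> - u \<in> vacuum_ideal k"
  using vacuum_ideal.left[of u k "- 1"] by simp

definition level :: complex where "level = - 7/2"

quotient_type vac_module = uea / "\<lambda>u w. u - w \<in> vacuum_ideal level"
proof (rule equivpI)
  show "reflp (\<lambda>u w. u - w \<in> vacuum_ideal level)"
    by (simp add: reflp_def vacuum_ideal.zero)
  show "symp (\<lambda>u w. u - w \<in> vacuum_ideal level)"
    by (rule sympI) (metis minus_diff_eq vacuum_ideal_uminus)
  show "transp (\<lambda>u w. u - w \<in> vacuum_ideal level)"
    proof (rule transpI)
    fix u w x :: uea
    assume "u - w \<in> vacuum_ideal level" "w - x \<in> vacuum_ideal level"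
    then have "(u - w) + (w - x) \<in> vacuum_ideal level" by (rule vacuum_ideal.add)
    then show "u - x \<in> vacuum_ideal level" by simp
  qed
qed

instantiation vac_module :: ab_group_add
begin

lift_definition zero_vac_module :: vac_module is 0 .

lift_definition plus_vac_module :: "vac_module \<Rightarrow> vac_module \<Rightarrow> vac_module" is "(+)"
  unfolding add_diff_add by (rule vacuum_ideal.add)

lift_definition uminus_vac_module :: "vac_module \<Rightarrow> vac_module" is uminus
  by (metis minus_diff_minus vacuum_ideal_uminus)

lift_definition minus_vac_module :: "vac_module \<Rightarrow> vac_module \<Rightarrow> vac_module" is "(-)"
proof -
  fix a b c d :: uea
  assume "a - b \<in> vacuum_ideal level" "c - d \<in> vacuum_ideal level"
  then have "(a - b) + - (c - d) \<in> vacuum_ideal level"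
    by (intro vacuum_ideal.add vacuum_ideal_uminus)
  then show "(a - c) - (b - d) \<in> vacuum_ideal level" by (simp add: algebra_simps)
qed

instance
  by standard (transfer; simp add: algebra_simps vacuum_ideal.zero)+

end

definition act :: "uea \<Rightarrow> vac_module \<Rightarrow> vac_module" (infixr \<open>\<odot>\<close> 70) where
  "u \<odot> v = abs_vac_module (u * rep_vac_module v)"

lemma act_abs: "u \<odot> abs_vac_module w = abs_vac_module (u * w)"
proof -
  have "rep_vac_module (abs_vac_module w) - w \<in> vacuum_ideal level"
    by (rule rep_abs_rsp_left[OF Quotient3_vac_module])
       (simp add: vacuum_ideal.zero)
  then have "u * rep_vac_module (abs_vac_module w) - u * w \<in> vacuum_ideal level"
    unfolding right_diff_distrib[symmetric] by (rule vacuum_ideal.left)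
  then show ?thesis
    by (simp add: act_def vac_module.abs_eq_iff)
qed

lift_definition vacuum :: vac_module is 1 .

definition vac_scale :: "complex \<Rightarrow> vac_module \<Rightarrow> vac_module" where
  "vac_scale c v = (c \<cdot> 1) \<odot> v"


section \<open>Weights and singular vectors\<close>

definition affine_cartan :: "affine set" where
  "affine_cartan = {affine_scale a central + affine_scale b derivation + loop x 0 | a b x. x \<in> sl_cartan}"

text \<open>
  Weights are linear functionals on the Cartan subalgebra; the following are given by formulas on
  the whole affine algebra, of which only the restriction to \<^const>\<open>affine_cartan\<close> matters.
  Since \<open>[d, x(m)] = m x(m)\<close> and \<open>d\<close> kills the vacuum, \<open>d = - L\<^sub>0\<close> on \<open>V\<^sup>k\<close>: the coefficient
  \<open>- n\<close> of \<open>delta\<close> in a weight means conformal weight \<open>n\<close>.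
\<close>

definition Lambda0 :: "affine \<Rightarrow> complex" where "Lambda0 X = fst (snd X)"

definition delta :: "affine \<Rightarrow> complex" where "delta X = snd (snd X)"

definition omega :: "nat \<Rightarrow> affine \<Rightarrow> complex" where
  "omega i X = (\<Sum>j = 1..i. Rep_sl6 (Poly_Mapping.lookup (fst X) 0) $ of_nat j $ of_nat j)"

lemma omega_coroot:
  assumes "i \<in> {1..5}" "j \<in> {1..5}"
  shows "omega i (loop (coroot j) 0) = (if i = j then 1 else 0)"
proof -
  have "i = 1 \<or> i = 2 \<or> i = 3 \<or> i = 4 \<or> i = 5" "j = 1 \<or> j = 2 \<or> j = 3 \<or> j = 4 \<or> j = 5"
    using assms by auto
  then show ?thesis
    by (elim disjE)
       (simp_all add: omega_def loop_def coroot.rep_eq matrix_unit_def numeral_eq_Suc)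
qed

definition weight_space :: "(affine \<Rightarrow> complex) \<Rightarrow> vac_module set" where
  "weight_space l = {v. \<forall>X\<in>affine_cartan. uea_gen X \<odot> v = vac_scale (l X) v}"

definition singular_vector :: "vac_module \<Rightarrow> bool" where
  "singular_vector v \<longleftrightarrow>
     v \<noteq> 0 \<and> (\<exists>l. v \<in> weight_space l) \<and>
     (\<forall>x\<in>sl_nplus. mode x 0 \<odot> v = 0) \<and>
     (\<forall>x. \<forall>m\<ge>1. mode x m \<odot> v = 0)"

section \<open>The explicit vector\<close>

context
begin

private abbreviation E :: "nat \<Rightarrow> nat \<Rightarrow> int \<Rightarrow> uea" where "E i j m \<equiv> mode (sl_unit i j) m"
private abbreviation H :: "nat \<Rightarrow> int \<Rightarrow> uea" where "H i m \<equiv> mode (coroot i) m"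
private abbreviation e :: "nat \<Rightarrow> nat \<Rightarrow> uea" where "e i j \<equiv> E i j (-1)"
private abbreviation f :: "nat \<Rightarrow> nat \<Rightarrow> uea" where "f i j \<equiv> E j i (-1)"
private abbreviation h :: "nat \<Rightarrow> uea" where "h i \<equiv> H i (-1)"

definition A_elt :: uea where
  "A_elt =
     E 1 5 (-3) * e 2 6 + 5/2 \<cdot> E 1 5 (-2) * E 2 6 (-2) - E 1 6 (-3) * e 2 5
     - 5/2 \<cdot> E 1 6 (-2) * E 2 5 (-2) - E 2 5 (-3) * e 1 6 + E 2 6 (-3) * e 1 5"

definition B_elt :: uea where
  "B_elt =
     - 7/5 \<cdot> E 1 5 (-2) * e 1 6 * f 1 2 - 5/3 \<cdot> E 1 5 (-2) * e 2 3 * e 3 6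
     - 5/3 \<cdot> E 1 5 (-2) * e 2 4 * e 4 6 - 5/3 \<cdot> E 1 5 (-2) * e 2 5 * e 5 6
     + E 1 5 (-2) * e 2 6 * (- h 2 - 1/3 \<cdot> h 3 + 1/3 \<cdot> h 4 + h 5)
     + e 1 5 * e 2 6 * (- 2/5 \<cdot> H 2 (-2) + 2/15 \<cdot> H 3 (-2) - 2/5 \<cdot> H 4 (-2))
     + 7/5 \<cdot> E 1 6 (-2) * e 1 5 * f 1 2 + 5/3 \<cdot> E 1 6 (-2) * e 2 3 * e 3 5
     + 5/3 \<cdot> E 1 6 (-2) * e 2 4 * e 4 5
     + E 1 6 (-2) * e 2 5 * (h 2 + 1/3 \<cdot> h 3 - 1/3 \<cdot> h 4 + 2/3 \<cdot> h 5)
     + 5/3 \<cdot> E 1 6 (-2) * e 2 6 * f 5 6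
     + e 1 6 * e 2 5 * (2/5 \<cdot> H 2 (-2) - 2/15 \<cdot> H 3 (-2) + 2/5 \<cdot> H 4 (-2))
     - 2/3 \<cdot> E 2 3 (-2) * e 1 5 * e 3 6 + 2/3 \<cdot> E 2 3 (-2) * e 1 6 * e 3 5
     - 2/3 \<cdot> E 2 4 (-2) * e 1 5 * e 4 6 + 2/3 \<cdot> E 2 4 (-2) * e 1 6 * e 4 5
     + E 2 5 (-2) * e 1 2 * e 2 6 + E 2 5 (-2) * e 1 3 * e 3 6 + E 2 5 (-2) * e 1 4 * e 4 6
     + 1/3 \<cdot> E 2 5 (-2) * e 1 5 * e 5 6
     + E 2 5 (-2) * e 1 6 * (h 1 + h 2 + 1/3 \<cdot> h 3 - 1/3 \<cdot> h 4 - 1/3 \<cdot> h 5)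
     - E 2 6 (-2) * e 1 2 * e 2 5 - E 2 6 (-2) * e 1 3 * e 3 5 - E 2 6 (-2) * e 1 4 * e 4 5
     + E 2 6 (-2) * e 1 5 * (- h 1 - h 2 - 1/3 \<cdot> h 3 + 1/3 \<cdot> h 4)
     - 1/3 \<cdot> E 2 6 (-2) * e 1 6 * f 5 6
     - 2/3 \<cdot> E 3 5 (-2) * e 1 3 * e 2 6 + 2/3 \<cdot> E 3 5 (-2) * e 1 6 * e 2 3
     + 2/3 \<cdot> E 3 6 (-2) * e 1 3 * e 2 5 - 2/3 \<cdot> E 3 6 (-2) * e 1 5 * e 2 3
     + 2/3 \<cdot> E 4 5 (-2) * e 1 4 * e 2 6 - 2/3 \<cdot> E 4 5 (-2) * e 1 6 * e 2 4
     - 2/3 \<cdot> E 4 6 (-2) * e 1 4 * e 2 5 + 2/3 \<cdot> E 4 6 (-2) * e 1 5 * e 2 4"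

definition C_elt :: uea where
  "C_elt =
     - 2/5 \<cdot> e 1 2 * e 1 5 * e 2 6 * f 1 2 + 2/5 \<cdot> e 1 2 * e 1 6 * e 2 5 * f 1 2
     + 2/3 \<cdot> e 1 2 * e 2 3 * e 2 5 * e 3 6 - 2/3 \<cdot> e 1 2 * e 2 3 * e 2 6 * e 3 5
     + 2/3 \<cdot> e 1 2 * e 2 4 * e 2 5 * e 4 6 - 2/3 \<cdot> e 1 2 * e 2 4 * e 2 6 * e 4 5
     + 2/3 \<cdot> e 1 2 * e 2 5 ^ 2 * e 5 6 - 2/3 \<cdot> e 1 2 * e 2 5 * e 2 6 * h 5
     - 2/3 \<cdot> e 1 2 * e 2 6 ^ 2 * f 5 6
     + 4/15 \<cdot> e 1 3 * e 1 5 * e 2 6 * f 1 3 - 2/3 \<cdot> e 1 3 * e 1 5 * e 3 6 * f 1 2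
     - 4/15 \<cdot> e 1 3 * e 1 6 * e 2 5 * f 1 3 + 2/3 \<cdot> e 1 3 * e 1 6 * e 3 5 * f 1 2
     + 2 \<cdot> e 1 3 * e 2 4 * e 3 5 * e 4 6 - 2 \<cdot> e 1 3 * e 2 4 * e 3 6 * e 4 5
     - 4/3 \<cdot> e 1 3 * e 2 5 * e 3 4 * e 4 6 + 2/3 \<cdot> e 1 3 * e 2 5 * e 3 5 * e 5 6
     + 2/3 \<cdot> e 1 3 * e 2 5 * e 3 6 * (- h 2 - h 3 + h 4)
     + 4/3 \<cdot> e 1 3 * e 2 6 * e 3 4 * e 4 5
     + 2/3 \<cdot> e 1 3 * e 2 6 * e 3 5 * (h 2 + h 3 - h 4 - h 5)
     - 2/3 \<cdot> e 1 3 * e 2 6 * e 3 6 * f 5 6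
     + 4/15 \<cdot> e 1 4 * e 1 5 * e 2 6 * f 1 4 - 2/3 \<cdot> e 1 4 * e 1 5 * e 4 6 * f 1 2
     - 4/15 \<cdot> e 1 4 * e 1 6 * e 2 5 * f 1 4 + 2/3 \<cdot> e 1 4 * e 1 6 * e 4 5 * f 1 2
     - 2 \<cdot> e 1 4 * e 2 3 * e 3 5 * e 4 6 + 2 \<cdot> e 1 4 * e 2 3 * e 3 6 * e 4 5
     - 4/3 \<cdot> e 1 4 * e 2 5 * e 3 6 * f 3 4 + 2/3 \<cdot> e 1 4 * e 2 5 * e 4 5 * e 5 6
     + 2/3 \<cdot> e 1 4 * e 2 5 * e 4 6 * (- h 2 + h 3 + h 4)
     + 4/3 \<cdot> e 1 4 * e 2 6 * e 3 5 * f 3 4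
     + 2/3 \<cdot> e 1 4 * e 2 6 * e 4 5 * (h 2 - h 3 - h 4 - h 5)
     - 2/3 \<cdot> e 1 4 * e 2 6 * e 4 6 * f 5 6
     + 4/15 \<cdot> e 1 5 ^ 2 * e 2 6 * f 1 5 - 2/3 \<cdot> e 1 5 ^ 2 * e 5 6 * f 1 2
     - 4/15 \<cdot> e 1 5 * e 1 6 * e 2 5 * f 1 5 + 4/15 \<cdot> e 1 5 * e 1 6 * e 2 6 * f 1 6
     + 2/3 \<cdot> e 1 5 * e 1 6 * f 1 2 * h 5 + 4/15 \<cdot> e 1 5 * e 2 3 * e 2 6 * f 2 3
     + 4/3 \<cdot> e 1 5 * e 2 3 * e 3 4 * e 4 6 - 2/3 \<cdot> e 1 5 * e 2 3 * e 3 5 * e 5 6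
     + 2/3 \<cdot> e 1 5 * e 2 3 * e 3 6 * (h 1 + h 2 + h 3 - h 4)
     + 4/15 \<cdot> e 1 5 * e 2 4 * e 2 6 * f 2 4 + 4/3 \<cdot> e 1 5 * e 2 4 * e 3 6 * f 3 4
     - 2/3 \<cdot> e 1 5 * e 2 4 * e 4 5 * e 5 6
     + 2/3 \<cdot> e 1 5 * e 2 4 * e 4 6 * (h 1 + h 2 - h 3 - h 4)
     + 4/15 \<cdot> e 1 5 * e 2 5 * e 2 6 * f 2 5 + 2/3 \<cdot> e 1 5 * e 2 5 * e 5 6 * h 1
     + 4/15 \<cdot> e 1 5 * e 2 6 * e 2 6 * f 2 6 - 16/15 \<cdot> e 1 5 * e 2 6 * e 3 4 * f 3 4
     + 4/15 \<cdot> e 1 5 * e 2 6 * e 3 5 * f 3 5 + 4/15 \<cdot> e 1 5 * e 2 6 * e 3 6 * f 3 6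
     + 4/15 \<cdot> e 1 5 * e 2 6 * e 4 5 * f 4 5 + 4/15 \<cdot> e 1 5 * e 2 6 * e 4 6 * f 4 6
     - 2/5 \<cdot> e 1 5 * e 2 6 * e 5 6 * f 5 6
     + e 1 5 * e 2 6 *
         (2/5 \<cdot> h 1 * h 2 + 2/15 \<cdot> h 1 * h 3 - 2/15 \<cdot> h 1 * h 4 - 2/5 \<cdot> h 1 * h 5 + 2/5 \<cdot> h 2 * h 2 + 4/15 \<cdot> h 2 * h 3
           - 4/15 \<cdot> h 2 * h 4 - 2/15 \<cdot> h 2 * h 5 - 2/15 \<cdot> h 3 * h 3 + 4/15 \<cdot> h 3 * h 4 + 2/15 \<cdot> h 3 * h 5 + 2/5 \<cdot> h 4 * h 4
           + 2/5 \<cdot> h 4 * h 5)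
     - 4/15 \<cdot> e 1 6 ^ 2 * e 2 5 * f 1 6 + 2/3 \<cdot> e 1 6 ^ 2 * f 1 2 * f 5 6
     - 4/15 \<cdot> e 1 6 * e 2 3 * e 2 5 * f 2 3 - 4/3 \<cdot> e 1 6 * e 2 3 * e 3 4 * e 4 5
     + 2/3 \<cdot> e 1 6 * e 2 3 * e 3 5 * (- h 1 - h 2 - h 3 + h 4 + h 5)
     + 2/3 \<cdot> e 1 6 * e 2 3 * e 3 6 * f 5 6
     - 4/15 \<cdot> e 1 6 * e 2 4 * e 2 5 * f 2 4 - 4/3 \<cdot> e 1 6 * e 2 4 * e 3 5 * f 3 4
     + 2/3 \<cdot> e 1 6 * e 2 4 * e 4 5 * (- h 1 - h 2 + h 3 + h 4 + h 5)
     + 2/3 \<cdot> e 1 6 * e 2 4 * e 4 6 * f 5 6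
     - 4/15 \<cdot> e 1 6 * e 2 5 ^ 2 * f 2 5 - 4/15 \<cdot> e 1 6 * e 2 5 * e 2 6 * f 2 6
     + 16/15 \<cdot> e 1 6 * e 2 5 * e 3 4 * f 3 4 - 4/15 \<cdot> e 1 6 * e 2 5 * e 3 5 * f 3 5
     - 4/15 \<cdot> e 1 6 * e 2 5 * e 3 6 * f 3 6 - 4/15 \<cdot> e 1 6 * e 2 5 * e 4 5 * f 4 5
     - 4/15 \<cdot> e 1 6 * e 2 5 * e 4 6 * f 4 6 + 2/5 \<cdot> e 1 6 * e 2 5 * e 5 6 * f 5 6
     + e 1 6 * e 2 5 *
         (- 2/5 \<cdot> h 1 * h 2 - 2/15 \<cdot> h 1 * h 3 + 2/15 \<cdot> h 1 * h 4 - 4/15 \<cdot> h 1 * h 5 - 2/5 \<cdot> h 2 * h 2 - 4/15 \<cdot> h 2 * h 3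
           + 4/15 \<cdot> h 2 * h 4 + 2/15 \<cdot> h 2 * h 5 + 2/15 \<cdot> h 3 * h 3 - 4/15 \<cdot> h 3 * h 4 - 2/15 \<cdot> h 3 * h 5 - 2/5 \<cdot> h 4 * h 4
           - 2/5 \<cdot> h 4 * h 5)
     - 2/3 \<cdot> e 1 6 * e 2 6 * f 5 6 * h 1"

end

end

theory Submission
  imports Defs
begin

text \<open>
  Annihilation by the simple root vectors and by \<open>f\<^sub>1\<^sub>6(1)\<close> is a finite computation: commuting a mode
  through a monomial and sorting yields a normal form modulo the left ideal of the vacuum module,
  and all coefficients cancel. The remaining positive modes are iterated brackets of these six.

  Nonvanishing cannot be seen by a contravariant form, since \<open>v\<close> lies in its radical. Instead, any
  character \<open>\<eta>\<close> of \<open>t\<^sup>-\<^sup>1sl(6)[t\<^sup>-\<^sup>1]\<close> extends to a linear functional on the vacuum module with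
  \<open>x(-m) u \<mapsto> \<eta>(x(-m)) \<eta>(u)\<close> for \<open>m > 0\<close>. It is constructed by recursion on words, without
  the theorem of Poincare, Birkhoff and Witt. A character that vanishes outside \<open>t\<^sup>-\<^sup>1sl(6)\<close> and is
  nonzero only on \<open>e\<^sub>1\<^sub>3\<close>, \<open>e\<^sub>2\<^sub>4\<close>, \<open>e\<^sub>3\<^sub>5\<close>, \<open>e\<^sub>4\<^sub>6\<close> picks the single term \<open>2 e\<^sub>1\<^sub>3 e\<^sub>2\<^sub>4 e\<^sub>3\<^sub>5 e\<^sub>4\<^sub>6\<close> of \<open>v\<close>.
\<close>

section \<open>Bilinearity of bracket, form and action\<close>

text \<open>The module is given only as a quotient, so \<open>v \<noteq> 0\<close> needs a
  functional that can be checked against the relators of the enveloping algebra and the generators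
  of the left ideal. It therefore has to be defined on words in arbitrary letters, not just on
  negative modes, and its compatibility with the commutator relators comes down to the Jacobi
  identity of the affine bracket; this is why that identity is proved in full. Characters are
  plentiful because a bracket of two negative modes has mode at most -2: any linear form on the
  modes -1 extends by zero. For the same reason, sorting a word in letters of mode -1 adds only
  terms that the character kills, so the coefficient that it reads off does not depend on the order
  of the factors. The weights of the four chosen root vectors add up to
  \<open>\<omega>2 + \<omega>4\<close>. The computation stays within the integers: doubled letters
  absorb the denominator of the level, and a common multiple clears those of the coefficients.
  Sorting before acting lets the cancellation be seen word by word.\<close>

lemma Rep_sl6_simps:
  "Rep_sl6 (x + y) = Rep_sl6 x + Rep_sl6 y" "Rep_sl6 (x - y) = Rep_sl6 x - Rep_sl6 y"
  "Rep_sl6 (- x) = - Rep_sl6 x" "Rep_sl6 0 = 0"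
  "Rep_sl6 (sl_scale c x) $ a $ b = c * Rep_sl6 x $ a $ b"
  by (simp_all add: plus_sl6.rep_eq minus_sl6.rep_eq uminus_sl6.rep_eq zero_sl6.rep_eq sl_scale.rep_eq)

lemma sl6_eqI: "(\<And>a b. Rep_sl6 x $ a $ b = Rep_sl6 y $ a $ b) \<Longrightarrow> x = y"
  by (simp add: Rep_sl6_inject[symmetric] vec_eq_iff)

lemma matrix_mult_distrib:
  fixes A :: "'a::comm_ring_1 ^ 'n::finite ^ 'm"
  shows "(A + B) ** C = A ** C + B ** C" "(A - B) ** C = A ** C - B ** C"
    "D ** (E + F) = D ** E + D ** (F :: 'a ^ 'k ^ 'n)" "D ** (E - F) = D ** E - D ** F"
  by (simp_all add: vec_eq_iff matrix_matrix_mult_def algebra_simps sum.distrib sum_subtractf)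

lemma sl_bracket_add_left: "sl_bracket (x + y) z = sl_bracket x z + sl_bracket y z"
  by transfer (simp add: matrix_mult_distrib)

lemma sl_bracket_swap: "sl_bracket y x = - sl_bracket x y"
  by transfer simp

lemma sl_bracket_scale_left: "sl_bracket (sl_scale c x) y = sl_scale c (sl_bracket x y)"
  by transfer
    (simp add: vec_eq_iff matrix_matrix_mult_def sum_distrib_left algebra_simps)

lemma sl_bracket_Jacobi:
  "sl_bracket x (sl_bracket y z) = sl_bracket (sl_bracket x y) z + sl_bracket y (sl_bracket x z)"
  by transfer (simp add: matrix_mult_distrib matrix_mul_assoc)

lemma sl_form_sym: "sl_form x y = sl_form y x"
  by transfer (rule trace_mul_sym)

lemma sl_form_add_left: "sl_form (x + y) z = sl_form x z + sl_form y z"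
  by transfer (simp add: matrix_mult_distrib trace_add)

lemma sl_form_add_right: "sl_form z (x + y) = sl_form z x + sl_form z y"
  by (metis sl_form_add_left sl_form_sym)

lemma sl_form_scale_left: "sl_form (sl_scale c x) y = c * sl_form x y"
  by transfer (simp add: trace_def matrix_matrix_mult_def sum_distrib_left algebra_simps)

lemma sl_form_scale_right: "sl_form x (sl_scale c y) = c * sl_form x y"
  by (metis sl_form_scale_left sl_form_sym)

lemma sl_form_invariant: "sl_form (sl_bracket x y) z = sl_form x (sl_bracket y z)"
proof (transfer, goal_cases)
  case (1 x y z)
  have "trace (y ** x ** z) = trace (x ** (z ** y))"
    by (metis matrix_mul_assoc trace_mul_sym)
  then show ?case
    by (simp add: matrix_mult_distrib trace_sub matrix_mul_assoc)
qed

section \<open>Scalars and commutators in the enveloping algebra\<close>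

lemma poly_mapping_induct [case_names zero add]:
  fixes p :: "'a \<Rightarrow>\<^sub>0 'b::monoid_add"
  assumes "P 0" and "\<And>k c p. P p \<Longrightarrow> P (Poly_Mapping.single k c + p)"
  shows "P p"
proof (induction p rule: update_induct)
  case (update p a b)
  then have "Poly_Mapping.update a b p = Poly_Mapping.single a b + p"
    by (intro poly_mapping_eqI) (auto simp: lookup_update lookup_add lookup_single in_keys_iff)
  with update assms(2) show ?case by simp
qed (rule assms(1))

lemma free_const_comm: "u * free_const c = free_const c * u"
proof (induction u rule: poly_mapping_induct)
  case (add k v p)
  then show ?case by (simp add: free_const_def mult_single plus_list_def mult.commute algebra_simps)
qed simp

lemma free_const_add: "free_const (c + d) = free_const c + free_const d"
  by (simp add: free_const_def single_add)

lemma free_const_mult: "free_const (c * d) = free_const c * free_const d"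
  by (simp add: free_const_def mult_single plus_list_def)

lemma free_const_one: "free_const 1 = 1"
  by (metis free_const_def single_one zero_list_def)

lemma uea_scale_add: "c \<cdot> (u + w) = c \<cdot> u + c \<cdot> w"
  by transfer (simp add: algebra_simps uea_ideal.zero)

lemma uea_scale_add_left: "(c + d) \<cdot> u = c \<cdot> u + d \<cdot> u"
  by transfer (simp add: free_const_add algebra_simps uea_ideal.zero)

lemma uea_scale_scale: "c \<cdot> d \<cdot> u = (c * d) \<cdot> u"
  by transfer (simp add: free_const_mult algebra_simps uea_ideal.zero)

lemma uea_scale_one: "1 \<cdot> u = u"
  by transfer (simp add: free_const_one uea_ideal.zero)

lemma uea_scale_mult_left: "(c \<cdot> u) * w = c \<cdot> (u * w)"
  by transfer (simp add: algebra_simps uea_ideal.zero)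

lemma uea_scale_mult_right: "u * (c \<cdot> w) = c \<cdot> (u * w)"
proof (transfer, goal_cases)
  case (1 u c w)
  have "u * (free_const c * w) = free_const c * (u * w)"
    by (metis free_const_comm mult.assoc)
  then show ?case by (simp add: uea_ideal.zero)
qed

global_interpretation uea: vector_space uea_scale
  by standard (simp_all add: uea_scale_add uea_scale_add_left uea_scale_scale uea_scale_one)

lemma uea_gen_add: "uea_gen (X + Y) = uea_gen X + uea_gen Y"
proof (transfer, goal_cases)
  case (1 X Y)
  have "free_gen (X + Y) - free_gen X - free_gen Y \<in> uea_ideal"
    by (rule uea_ideal.relator) (unfold uea_relators_def, blast)
  then show ?case by (simp add: algebra_simps)
qed

lemma uea_gen_scale: "uea_gen (affine_scale c X) = c \<cdot> uea_gen X"
  by transfer (rule uea_ideal.relator, unfold uea_relators_def, blast)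

lemma uea_gen_commute: "uea_gen X * uea_gen Y = uea_gen Y * uea_gen X + uea_gen (affine_bracket X Y)"
proof (transfer, goal_cases)
  case (1 X Y)
  have "free_gen X * free_gen Y - free_gen Y * free_gen X - free_gen (affine_bracket X Y) \<in> uea_ideal"
    by (rule uea_ideal.relator) (unfold uea_relators_def, blast)
  then show ?case by (simp add: algebra_simps)
qed

lemma loop_add: "loop (x + y) m = loop x m + loop y m"
  by (simp add: loop_def single_add)

lemma loop_scale: "loop (sl_scale c x) m = affine_scale c (loop x m)"
  by (cases "x = 0") (simp_all add: loop_def map_single)

lemma mode_add: "mode (x + y) m = mode x m + mode y m"
  by (simp add: mode_def loop_add uea_gen_add)

lemma mode_scale: "mode (sl_scale c x) m = c \<cdot> mode x m"
  by (simp add: mode_def loop_scale uea_gen_scale)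

lemma mode_zero: "mode 0 m = 0"
  using mode_scale[of 0 0 m] by simp

lemma mode_commute:
  "mode x m * mode y n = mode y n * mode x m + mode (sl_bracket x y) (m + n)
     + (if m + n = 0 then of_int m * sl_form x y else 0) \<cdot> uea_gen central"
  unfolding mode_def uea_gen_commute[of "loop x m"] affine_bracket_loop_loop uea_gen_add uea_gen_scale
  by (simp add: add.assoc)

lemma uea_gen_zero: "uea_gen 0 = 0"
proof -
  have "uea_gen (0 + 0) = uea_gen 0 + uea_gen 0" by (rule uea_gen_add)
  then show ?thesis by simp
qed

lemma central_commute: "uea_gen central * uea_gen X = uea_gen X * uea_gen central"
  by (simp add: uea_gen_commute[of central] affine_bracket_central uea_gen_zero)

section \<open>The action on the vacuum module\<close>

lemma act_vacuum: "u \<odot> vacuum = abs_vac_module u"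
  by (simp add: vacuum.abs_eq act_abs)

lemma act_mult: "(u * w) \<odot> v = u \<odot> (w \<odot> v)"
  by (simp add: act_def[of w] act_def[of "u * w"] act_abs mult.assoc)

lemma act_add_left: "(u + w) \<odot> v = u \<odot> v + w \<odot> v"
  by (simp add: act_def plus_vac_module.abs_eq distrib_right)

lemma act_zero_left: "0 \<odot> v = 0"
  by (simp add: act_def zero_vac_module.abs_eq)

lemma act_zero_right: "u \<odot> 0 = 0"
  by (simp add: zero_vac_module.abs_eq act_abs)

lemma act_add_right: "u \<odot> (v + w) = u \<odot> v + u \<odot> w"
  by (induct v rule: vac_module.abs_induct, induct w rule: vac_module.abs_induct)
    (simp add: plus_vac_module.abs_eq act_abs distrib_left)

lemma act_scale: "(c \<cdot> u) \<odot> v = vac_scale c (u \<odot> v)"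
  by (simp add: vac_scale_def act_mult[symmetric] uea_scale_mult_left)

lemma abs_vac_eq_0_iff: "abs_vac_module u = 0 \<longleftrightarrow> u \<in> vacuum_ideal level"
  by (simp add: zero_vac_module.abs_eq vac_module.abs_eq_iff)

lemma nonneg_mode_vacuum: "0 \<le> m \<Longrightarrow> mode x m \<odot> vacuum = 0"
  by (simp add: act_vacuum abs_vac_eq_0_iff vacuum_ideal.nonneg)

lemma derivation_vacuum: "uea_gen derivation \<odot> vacuum = 0"
  by (simp add: act_vacuum abs_vac_eq_0_iff vacuum_ideal.derivation)

lemma central_vacuum: "uea_gen central \<odot> vacuum = vac_scale level vacuum"
  by (simp add: act_vacuum vac_scale_def vac_module.abs_eq_iff vacuum_ideal.central)

section \<open>The affine bracket is a Lie bracket\<close>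

lemma loop_deriv_lookup: "Poly_Mapping.lookup (loop_deriv p) m = sl_scale (of_int m) (Poly_Mapping.lookup p m)"
  by (auto simp: loop_deriv_def lookup_mapp when_def in_keys_iff)

lemma loop_deriv_add: "loop_deriv (p + q) = loop_deriv p + loop_deriv q"
  by (rule poly_mapping_eqI) (simp add: loop_deriv_lookup lookup_add sl6.scale_right_distrib)

lemma lookup_map_scale: "Poly_Mapping.lookup (Poly_Mapping.map (sl_scale c) p) m = sl_scale c (Poly_Mapping.lookup p m)"
  by (auto simp: Poly_Mapping.map.rep_eq when_def)

lemma map_scale_add:
  "Poly_Mapping.map (sl_scale c) (p + q) = Poly_Mapping.map (sl_scale c) p + Poly_Mapping.map (sl_scale c) q"
  by (rule poly_mapping_eqI) (simp add: lookup_map_scale lookup_add sl6.scale_right_distrib)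

lemma map_scale_add_left:
  "Poly_Mapping.map (sl_scale (c + d)) p = Poly_Mapping.map (sl_scale c) p + Poly_Mapping.map (sl_scale d) p"
  by (rule poly_mapping_eqI) (simp add: lookup_map_scale lookup_add sl6.scale_left_distrib)

lemma map_scale_scale:
  "Poly_Mapping.map (sl_scale c) (Poly_Mapping.map (sl_scale d) p) = Poly_Mapping.map (sl_scale (c * d)) p"
  by (rule poly_mapping_eqI) (simp add: lookup_map_scale)

definition loop_bracket :: "(int \<Rightarrow>\<^sub>0 sl6) \<Rightarrow> (int \<Rightarrow>\<^sub>0 sl6) \<Rightarrow> (int \<Rightarrow>\<^sub>0 sl6)" where
  "loop_bracket p q = (\<Sum>m\<in>Poly_Mapping.keys p. \<Sum>n\<in>Poly_Mapping.keys q.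
     Poly_Mapping.single (m + n) (sl_bracket (Poly_Mapping.lookup p m) (Poly_Mapping.lookup q n)))"

definition cocycle :: "(int \<Rightarrow>\<^sub>0 sl6) \<Rightarrow> (int \<Rightarrow>\<^sub>0 sl6) \<Rightarrow> complex" where
  "cocycle p q = (\<Sum>m\<in>Poly_Mapping.keys p.
     of_int m * sl_form (Poly_Mapping.lookup p m) (Poly_Mapping.lookup q (- m)))"

text \<open>The keys of a sum can be fewer than the union of the keys, because of cancellation. Sums
  over a common finite superset can be added termwise, which gives additivity.\<close>

lemma loop_bracket_superset:
  assumes "finite A" "finite B" "Poly_Mapping.keys p \<subseteq> A" "Poly_Mapping.keys q \<subseteq> B"
  shows "loop_bracket p q = (\<Sum>m\<in>A. \<Sum>n\<in>B.
     Poly_Mapping.single (m + n) (sl_bracket (Poly_Mapping.lookup p m) (Poly_Mapping.lookup q n)))"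
proof -
  have "loop_bracket p q = (\<Sum>m\<in>Poly_Mapping.keys p. \<Sum>n\<in>B.
     Poly_Mapping.single (m + n) (sl_bracket (Poly_Mapping.lookup p m) (Poly_Mapping.lookup q n)))"
    unfolding loop_bracket_def using assms
    by (intro sum.cong sum.mono_neutral_left) (auto simp: in_keys_iff)
  also have "\<dots> = (\<Sum>m\<in>A. \<Sum>n\<in>B.
     Poly_Mapping.single (m + n) (sl_bracket (Poly_Mapping.lookup p m) (Poly_Mapping.lookup q n)))"
    using assms by (intro sum.mono_neutral_left) (auto simp: in_keys_iff)
  finally show ?thesis .
qed

lemma cocycle_superset:
  assumes "finite A" "Poly_Mapping.keys p \<subseteq> A"
  shows "cocycle p q = (\<Sum>m\<in>A. of_int m * sl_form (Poly_Mapping.lookup p m) (Poly_Mapping.lookup q (- m)))"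
  unfolding cocycle_def using assms
  by (intro sum.mono_neutral_left) (auto simp: in_keys_iff)

lemma loop_bracket_add_left: "loop_bracket (p + p') q = loop_bracket p q + loop_bracket p' q"
proof -
  let ?A = "Poly_Mapping.keys p \<union> Poly_Mapping.keys p'"
  have "Poly_Mapping.keys (p + p') \<subseteq> ?A" by (rule keys_add)
  then show ?thesis
    by (subst (1 2 3) loop_bracket_superset[of ?A "Poly_Mapping.keys q"])
      (auto simp: lookup_add sl_bracket_add_left single_add sum.distrib)
qed

lemma loop_bracket_swap: "loop_bracket q p = - loop_bracket p q"
  unfolding loop_bracket_def sum_negf[symmetric] single_uminus[symmetric]
  by (subst sum.swap) (simp add: add.commute sl_bracket_swap[symmetric])

lemma loop_bracket_scale_left: "loop_bracket (Poly_Mapping.map (sl_scale c) p) q = Poly_Mapping.map (sl_scale c) (loop_bracket p q)"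
proof -
  have *: "Poly_Mapping.map (sl_scale c) (sum f A) = (\<Sum>x\<in>A. Poly_Mapping.map (sl_scale c) (f x))"
    for f :: "int \<Rightarrow> int \<Rightarrow>\<^sub>0 sl6" and A
    by (induction A rule: infinite_finite_induct) (simp_all add: map_scale_add)
  have **: "Poly_Mapping.map (sl_scale c) (Poly_Mapping.single k x) = Poly_Mapping.single k (sl_scale c x)"
    for k :: int and x
    by (rule poly_mapping_eqI) (simp add: lookup_map_scale lookup_single when_def)
  have "Poly_Mapping.keys (Poly_Mapping.map (sl_scale c) p) \<subseteq> Poly_Mapping.keys p"
    by (auto simp: in_keys_iff lookup_map_scale)
  then show ?thesis
    by (subst loop_bracket_superset[of "Poly_Mapping.keys p" "Poly_Mapping.keys q"])
      (auto simp: loop_bracket_def lookup_map_scale sl_bracket_scale_left * **)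
qed

lemma cocycle_add_left: "cocycle (p + p') q = cocycle p q + cocycle p' q"
proof -
  let ?A = "Poly_Mapping.keys p \<union> Poly_Mapping.keys p'"
  have "Poly_Mapping.keys (p + p') \<subseteq> ?A" by (rule keys_add)
  then show ?thesis
    by (subst (1 2 3) cocycle_superset[of ?A])
      (auto simp: lookup_add sl_form_add_left distrib_left sum.distrib)
qed

lemma cocycle_scale_left: "cocycle (Poly_Mapping.map (sl_scale c) p) q = c * cocycle p q"
proof -
  have "Poly_Mapping.keys (Poly_Mapping.map (sl_scale c) p) \<subseteq> Poly_Mapping.keys p"
    by (auto simp: in_keys_iff lookup_map_scale)
  then show ?thesis
    by (subst cocycle_superset[of "Poly_Mapping.keys p"])
      (auto simp: cocycle_def lookup_map_scale sl_form_scale_left sum_distrib_left algebra_simps)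
qed

text \<open>Reflecting the summation index, \<open>m\<close> to \<open>- m\<close>, exchanges the
  two arguments of the symmetric form, and the factor \<open>m\<close> supplies the sign.\<close>

lemma cocycle_swap: "cocycle q p = - cocycle p q"
proof -
  let ?A = "Poly_Mapping.keys p \<union> uminus ` Poly_Mapping.keys q"
  have "cocycle p q = (\<Sum>m\<in>?A. of_int m * sl_form (Poly_Mapping.lookup p m) (Poly_Mapping.lookup q (- m)))"
    by (rule cocycle_superset) auto
  also have "\<dots> = (\<Sum>m\<in>uminus ` ?A. - (of_int m * sl_form (Poly_Mapping.lookup q m) (Poly_Mapping.lookup p (- m))))"
    by (subst sum.reindex) (auto simp: sl_form_sym intro!: sum.cong)
  also have "\<dots> = - cocycle q p"
    unfolding sum_negf by (subst cocycle_superset[of "uminus ` ?A"]) (auto simp: image_image image_Un)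
  finally show ?thesis by simp
qed

lemma affine_bracket_loop_bracket:
  "affine_bracket (p, a, b) (q, a', b') =
     (loop_bracket p q + Poly_Mapping.map (sl_scale b) (loop_deriv q) - Poly_Mapping.map (sl_scale b') (loop_deriv p),
      cocycle p q, 0)"
  by (simp add: loop_bracket_def cocycle_def)

declare affine_bracket.simps [simp del]

lemma affine_bracket_add_left: "affine_bracket (X + Y) Z = affine_bracket X Z + affine_bracket Y Z"
  by (cases X; cases Y; cases Z)
    (simp add: affine_bracket_loop_bracket loop_bracket_add_left cocycle_add_left map_scale_add map_scale_add_left loop_deriv_add)

lemma affine_bracket_swap: "affine_bracket Y X = - affine_bracket X Y"
proof (cases X; cases Y)
  fix p a b q a' b'
  assume "X = (p, a, b)" "Y = (q, a', b')"
  then show ?thesis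
    using loop_bracket_swap[of q p] cocycle_swap[of q p] by (simp add: affine_bracket_loop_bracket)
qed

lemma affine_bracket_add_right: "affine_bracket Z (X + Y) = affine_bracket Z X + affine_bracket Z Y"
  by (simp add: affine_bracket_swap[of Z] affine_bracket_add_left)

lemma affine_scale_add: "affine_scale c (X + Y) = affine_scale c X + affine_scale c Y"
  by (cases X; cases Y) (simp add: map_scale_add algebra_simps)

lemma affine_scale_add_left: "affine_scale (c + d) X = affine_scale c X + affine_scale d X"
  by (cases X) (simp add: map_scale_add_left algebra_simps)

lemma affine_scale_one: "affine_scale 1 X = X"
  by (cases X) (auto intro!: poly_mapping_eqI simp: lookup_map_scale)

lemma affine_scale_scale: "affine_scale c (affine_scale d X) = affine_scale (c * d) X"
  by (cases X) (simp add: map_scale_scale)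

global_interpretation affine: vector_space affine_scale
  by standard (simp_all add: affine_scale_add affine_scale_add_left affine_scale_one affine_scale_scale)

lemma affine_bracket_scale_left: "affine_bracket (affine_scale c X) Y = affine_scale c (affine_bracket X Y)"
proof (cases X; cases Y)
  fix p a b q a' b'
  assume [simp]: "X = (p, a, b)" "Y = (q, a', b')"
  show ?thesis
    by (auto simp: affine_bracket_loop_bracket loop_bracket_scale_left cocycle_scale_left
        intro!: poly_mapping_eqI)
      (simp add: lookup_map_scale lookup_add lookup_minus loop_deriv_lookup
        sl6.scale_right_distrib sl6.scale_right_diff_distrib algebra_simps)
qed

lemma affine_bracket_scale_right: "affine_bracket X (affine_scale c Y) = affine_scale c (affine_bracket X Y)"
  by (simp add: affine_bracket_swap[of X] affine_bracket_scale_left affine.scale_minus_right)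

lemma affine_bracket_zero: "affine_bracket 0 X = 0" "affine_bracket X 0 = 0"
  using affine_bracket_scale_left[of 0 0 X] affine_bracket_scale_right[of X 0 0] by simp_all

text \<open>Identities that are linear in an argument need checking only for loops, \<open>K\<close>
  and \<open>d\<close>.\<close>

lemma affine_induct [case_names loop central derivation add scale]:
  assumes "\<And>x m. P (loop x m)" "P central" "P derivation"
    and add: "\<And>X Y. P X \<Longrightarrow> P Y \<Longrightarrow> P (X + Y)" and scale: "\<And>c X. P X \<Longrightarrow> P (affine_scale c X)"
  shows "P X"
proof (cases X)
  case (fields p a b)
  have "P (p, 0, 0)"
  proof (induction p rule: poly_mapping_induct)
    case zero
    show ?case using assms(1)[of 0 0] by (simp add: loop_def)
  next
    case (add k x p)
    have "(Poly_Mapping.single k x + p, 0, 0) = loop x k + (p, 0, 0)" by (simp add: loop_def)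
    with add show ?case by (simp only: assms)
  qed
  moreover have "X = (p, 0, 0) + (affine_scale a central + affine_scale b derivation)"
    by (simp add: fields central_def derivation_def)
  ultimately show ?thesis by (simp only: assms)
qed

section \<open>The Jacobi identity, from generators to all elements\<close>

lemma affine_bracket_central_right: "affine_bracket X central = 0"
  by (simp add: affine_bracket_swap[of X] affine_bracket_central)

lemma affine_bracket_loop_derivation:
  "affine_bracket (loop x m) derivation = affine_scale (- of_int m) (loop x m)"
  by (simp add: affine_bracket_swap[of "loop x m"] affine_bracket_derivation_loop)

lemma affine_bracket_derivation_derivation: "affine_bracket derivation derivation = 0"
  by (simp add: derivation_def affine_bracket_loop_bracket loop_bracket_def cocycle_def zero_prod_def)

lemmas affine_bracket_gens = affine_bracket_central affine_bracket_central_right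
  affine_bracket_loop_derivation affine_bracket_derivation_loop affine_bracket_loop_loop
  affine_bracket_derivation_derivation affine_bracket_zero

lemma sl_form_minus_left: "sl_form (- x) y = - sl_form x y"
  using sl_form_scale_left[of "- 1" x y] by simp

lemmas affine_bracket_linear = affine_bracket_add_left affine_bracket_add_right
  affine_bracket_scale_left affine_bracket_scale_right

text \<open>The loop part is the Jacobi identity of sl(6). By invariance all three central terms are
  multiples of \<open>sl_form (sl_bracket x y) z\<close>, with coefficients \<open>m\<close>,
  \<open>m + n\<close> and \<open>- n\<close>.\<close>

lemma affine_Jacobi_loops:
  "affine_bracket (loop x m) (affine_bracket (loop y n) (loop z r)) =
     affine_bracket (affine_bracket (loop x m) (loop y n)) (loop z r)
       + affine_bracket (loop y n) (affine_bracket (loop x m) (loop z r))"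
proof -
  let ?F = "sl_form (sl_bracket x y) z"
  have l: "loop (sl_bracket x (sl_bracket y z)) k =
      loop (sl_bracket (sl_bracket x y) z) k + loop (sl_bracket y (sl_bracket x z)) k" for k
    by (subst sl_bracket_Jacobi) (simp add: loop_add)
  have a: "sl_form x (sl_bracket y z) = ?F"
    by (simp add: sl_form_invariant)
  have b: "sl_form y (sl_bracket x z) = - ?F"
    by (simp add: sl_form_invariant[symmetric] sl_bracket_swap[of y] sl_form_minus_left)
  have c: "(if m + n + r = 0 then of_int m * ?F else 0) =
      (if m + n + r = 0 then of_int (m + n) * ?F else 0) + (if m + n + r = 0 then of_int n * - ?F else 0)"
    by (simp add: algebra_simps)
  have idx: "m + (n + r) = m + n + r" "n + (m + r) = m + n + r" by simp_all
  show ?thesis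
    unfolding affine_bracket_gens affine_bracket_linear affine.scale_zero_right add_0_right
      idx l a b c affine_scale_add_left by (simp add: add_ac)
qed

text \<open>Bracketing with \<open>d\<close> multiplies by the degree, and degrees add. A central
  term occurs only in total degree 0, where \<open>d\<close> gives 0 on the left and the factors
  \<open>m\<close> and \<open>n\<close> cancel on the right.\<close>

lemma affine_Jacobi_derivation:
  "affine_bracket derivation (affine_bracket (loop x m) (loop y n)) =
     affine_bracket (affine_bracket derivation (loop x m)) (loop y n)
       + affine_bracket (loop x m) (affine_bracket derivation (loop y n))"
proof (cases "m + n = 0")
  case True
  then have "(of_int m + of_int n :: complex) = 0"
    by (metis of_int_add of_int_0)
  then have *: "affine_scale (of_int m) X + affine_scale (of_int n) X = 0" for X
    by (simp add: affine_scale_add_left[symmetric])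
  show ?thesis using True by (simp add: affine_bracket_gens affine_bracket_linear *)
qed (simp add: affine_bracket_gens affine_bracket_linear affine_scale_add_left)

text \<open>The defect of the Jacobi identity is trilinear and changes sign when neighbouring
  arguments are swapped. Up to order, the triples of generators left are three loops,
  \<open>d\<close> with two loops, and those containing \<open>d\<close> twice; a triple with
  \<open>K\<close> contributes nothing.\<close>

definition jacobiator :: "affine \<Rightarrow> affine \<Rightarrow> affine \<Rightarrow> affine" where
  "jacobiator X Y Z = affine_bracket X (affine_bracket Y Z) - affine_bracket (affine_bracket X Y) Z
     - affine_bracket Y (affine_bracket X Z)"

lemma jacobiator_add:
  "jacobiator (X + X') Y Z = jacobiator X Y Z + jacobiator X' Y Z" "jacobiator X (Y + Y') Z = jacobiator X Y Z + jacobiator X Y' Z"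
  "jacobiator X Y (Z + Z') = jacobiator X Y Z + jacobiator X Y Z'"
  by (simp_all add: jacobiator_def affine_bracket_linear)

lemma jacobiator_scale:
  "jacobiator (affine_scale c X) Y Z = affine_scale c (jacobiator X Y Z)"
  "jacobiator X (affine_scale c Y) Z = affine_scale c (jacobiator X Y Z)"
  "jacobiator X Y (affine_scale c Z) = affine_scale c (jacobiator X Y Z)"
  by (simp_all add: jacobiator_def affine_bracket_linear affine.scale_right_diff_distrib)

lemma affine_bracket_minus_left: "affine_bracket (- X) Y = - affine_bracket X Y"
  using affine_bracket_scale_left[of "- 1" X Y] by simp

lemma jacobiator_swap: "jacobiator Y X Z = - jacobiator X Y Z"
  by (simp add: jacobiator_def affine_bracket_swap[of Y X] affine_bracket_minus_left)

lemma jacobiator_swap': "jacobiator X Z Y = - jacobiator X Y Z"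
proof -
  have "affine_bracket X (affine_bracket Z Y) = - affine_bracket X (affine_bracket Y Z)"
    using affine_bracket_scale_right[of X "- 1" "affine_bracket Y Z"] by (simp add: affine_bracket_swap[of Z Y])
  then show ?thesis
    by (simp add: jacobiator_def affine_bracket_swap[of Z "affine_bracket X Y"]
        affine_bracket_swap[of Y "affine_bracket X Z"])
qed

lemma jacobiator_central: "jacobiator central Y Z = 0" "jacobiator X central Z = 0" "jacobiator X Y central = 0"
  by (simp_all add: jacobiator_def affine_bracket_gens)

lemma jacobiator_derivation: "jacobiator derivation derivation Z = 0"
  by (simp add: jacobiator_def affine_bracket_gens)

lemma jacobiator_zero: "jacobiator X Y Z = 0"
proof -
  have 1: "jacobiator (loop x m) (loop y n) Z = 0" for x m y n Z
  proof (induction Z rule: affine_induct)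
    case (loop z r)
    show ?case unfolding jacobiator_def by (subst affine_Jacobi_loops) simp
  next
    case derivation
    have "jacobiator derivation (loop x m) (loop y n) = 0"
      unfolding jacobiator_def by (subst affine_Jacobi_derivation) simp
    then show ?case
      using jacobiator_swap'[of "loop x m" "loop y n" derivation] jacobiator_swap[of "loop x m" derivation "loop y n"] by simp
  qed (simp_all add: jacobiator_central jacobiator_add jacobiator_scale jacobiator_derivation)
  have 2: "jacobiator (loop x m) Y Z = 0" for x m Y Z
  proof (induction Y rule: affine_induct)
    case (loop y n)
    show ?case by (rule 1)
  next
    case derivation
    show ?case
    proof (induction Z rule: affine_induct)
      case (loop z r)
      show ?case using 1[of x m z r derivation] jacobiator_swap'[of "loop x m" "loop z r" derivation] by simp
    next
      case derivation
      show ?case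
        using jacobiator_swap[of "loop x m" derivation derivation] jacobiator_swap'[of derivation "loop x m" derivation]
        by (simp add: jacobiator_derivation)
    qed (simp_all add: jacobiator_central jacobiator_add jacobiator_scale)
  qed (simp_all add: jacobiator_central jacobiator_add jacobiator_scale)
  show ?thesis
  proof (induction X rule: affine_induct)
    case derivation
    show ?case
    proof (induction Y rule: affine_induct)
      case (loop y n)
      show ?case using 2[of y n derivation Z] jacobiator_swap[of "loop y n" derivation Z] by simp
    qed (simp_all add: jacobiator_central jacobiator_add jacobiator_scale jacobiator_derivation)
  qed (simp_all add: 2 jacobiator_central jacobiator_add jacobiator_scale)
qed

lemma affine_Jacobi:
  "affine_bracket X (affine_bracket Y Z) =
     affine_bracket (affine_bracket X Y) Z + affine_bracket Y (affine_bracket X Z)"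
  using jacobiator_zero[of X Y Z] by (simp add: jacobiator_def algebra_simps)

section \<open>A Whittaker functional on the vacuum module\<close>

text \<open>The projection of the affine algebra onto \<open>sl(6)[t] \<oplus> \<complex>d\<close> along \<open>t\<^sup>-\<^sup>1sl(6)[t\<^sup>-\<^sup>1] \<oplus> \<complex>K\<close>.\<close>

definition nonneg :: "affine \<Rightarrow> affine" where
  "nonneg X = (Poly_Mapping.mapp (\<lambda>m x. if 0 \<le> m then x else 0) (fst X), 0, snd (snd X))"

lemma lookup_nonneg: "Poly_Mapping.lookup (fst (nonneg X)) m = (if 0 \<le> m then Poly_Mapping.lookup (fst X) m else 0)"
  by (auto simp: nonneg_def lookup_mapp when_def in_keys_iff)

lemma affine_eqI:
  assumes "\<And>m. Poly_Mapping.lookup (fst X) m = Poly_Mapping.lookup (fst Y) m" "snd X = snd Y"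
  shows "X = Y"
  using assms by (auto intro!: prod_eqI poly_mapping_eqI)

lemma nonneg_add: "nonneg (X + Y) = nonneg X + nonneg Y"
  by (rule affine_eqI) (auto simp: lookup_nonneg lookup_add, simp add: nonneg_def)

lemma affine_scale_sel:
  "Poly_Mapping.lookup (fst (affine_scale c X)) m = sl_scale c (Poly_Mapping.lookup (fst X) m)"
  "fst (snd (affine_scale c X)) = c * fst (snd X)" "snd (snd (affine_scale c X)) = c * snd (snd X)"
  by (cases X; simp add: lookup_map_scale)+

lemma nonneg_scale: "nonneg (affine_scale c X) = affine_scale c (nonneg X)"
  by (rule affine_eqI) (auto simp: lookup_nonneg affine_scale_sel, auto simp: nonneg_def affine_scale_sel intro!: prod_eqI)

lemma loop_sel:
  "Poly_Mapping.lookup (fst (loop x m)) n = (if n = m then x else 0)" "snd (loop x m) = (0, 0)"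
  by (simp_all add: loop_def lookup_single when_def)

lemma nonneg_loop: "nonneg (loop x m) = (if 0 \<le> m then loop x m else 0)"
  by (rule affine_eqI) (auto simp: lookup_nonneg loop_sel, auto simp: nonneg_def loop_sel zero_prod_def)

lemma nonneg_central: "nonneg central = 0"
  by (rule affine_eqI) (auto simp: lookup_nonneg central_def, auto simp: nonneg_def zero_prod_def)

lemma nonneg_derivation: "nonneg derivation = derivation"
  by (rule affine_eqI) (auto simp: lookup_nonneg derivation_def, auto simp: nonneg_def)

lemma nonneg_zero: "nonneg 0 = 0"
  using nonneg_scale[of 0 0] by simp

lemma nonneg_diff: "nonneg (X - Y) = nonneg X - nonneg Y"
  using nonneg_add[of "X - Y" Y] by (simp add: algebra_simps)

lemma nonneg_minus: "nonneg (- X) = - nonneg X"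
  using nonneg_diff[of 0 X] by (simp add: nonneg_zero)

text \<open>Under the trace form these transposed units read off the coefficients of
  \<open>e13\<close>, \<open>e24\<close>, \<open>e35\<close> and \<open>e46\<close>.\<close>

definition whit_elt :: sl6 where
  "whit_elt = sl_unit 3 1 + sl_unit 4 2 + sl_unit 5 3 + sl_unit 6 4"

definition whit_char :: "affine \<Rightarrow> complex" where
  "whit_char X = sl_form whit_elt (Poly_Mapping.lookup (fst X) (- 1)) + level * fst (snd X)"

lemma whit_char_add: "whit_char (X + Y) = whit_char X + whit_char Y"
  by (simp add: whit_char_def lookup_add sl_form_add_right algebra_simps)

lemma whit_char_scale: "whit_char (affine_scale c X) = c * whit_char X"
  by (simp add: whit_char_def affine_scale_sel sl_form_scale_right algebra_simps)

lemma whit_char_zero: "whit_char 0 = 0"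
  using whit_char_scale[of 0 0] by simp

lemma whit_char_diff: "whit_char (X - Y) = whit_char X - whit_char Y"
  using whit_char_add[of "X - Y" Y] by simp

lemma whit_char_minus: "whit_char (- X) = - whit_char X"
  using whit_char_diff[of 0 X] by (simp add: whit_char_zero)

lemma whit_char_loop: "whit_char (loop x m) = (if m = - 1 then sl_form whit_elt x else 0)"
  by (simp add: whit_char_def loop_sel)

lemma whit_char_central: "whit_char central = level"
  by (simp add: whit_char_def central_def)

lemma whit_char_derivation: "whit_char derivation = 0"
  by (simp add: whit_char_def derivation_def)

lemmas nonneg_whit_char_simps = nonneg_minus nonneg_add nonneg_scale nonneg_zero nonneg_loop
  nonneg_central nonneg_derivation whit_char_minus whit_char_add whit_char_scale whit_char_zero
  whit_char_loop whit_char_central affine_bracket_linear affine_bracket_gens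

text \<open>For nonnegative modes \<open>m + n = 0\<close> forces \<open>m = 0\<close>, so the
  cocycle vanishes and no multiple of \<open>K\<close> appears on which the character could be
  nonzero.\<close>

lemma nonneg_subalgebra:
  "nonneg (affine_bracket (nonneg X) (nonneg Y)) = affine_bracket (nonneg X) (nonneg Y)"
  "whit_char (affine_bracket (nonneg X) (nonneg Y)) = 0"
proof -
  have "nonneg (affine_bracket (nonneg X) (nonneg Y)) = affine_bracket (nonneg X) (nonneg Y)
      \<and> whit_char (affine_bracket (nonneg X) (nonneg Y)) = 0"
  proof (induction X rule: affine_induct)
    case X: (loop x m)
    show ?case
    proof (induction Y rule: affine_induct)
      case (loop y n)
      then show ?case
        by (auto simp: nonneg_whit_char_simps)
    qed (auto simp: nonneg_whit_char_simps)
  next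
    case derivation
    show ?case
      by (induction Y rule: affine_induct)
        (auto simp: nonneg_whit_char_simps)
  qed (auto simp: nonneg_whit_char_simps)
  then show "nonneg (affine_bracket (nonneg X) (nonneg Y)) = affine_bracket (nonneg X) (nonneg Y)"
    "whit_char (affine_bracket (nonneg X) (nonneg Y)) = 0" by auto
qed

text \<open>Negative modes bracket into modes at most -2: too low for a central term and invisible
  to a character supported in mode -1. This is the reason that any linear form on mode -1 is
  admissible.\<close>

lemma neg_subalgebra:
  "nonneg (affine_bracket (X - nonneg X) (Y - nonneg Y)) = 0" "whit_char (affine_bracket (X - nonneg X) (Y - nonneg Y)) = 0"
proof -
  have add: "(X + Z) - nonneg (X + Z) = (X - nonneg X) + (Z - nonneg Z)" for X Z
    by (simp add: nonneg_add)
  have scale: "affine_scale c X - nonneg (affine_scale c X) = affine_scale c (X - nonneg X)" for c X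
    by (simp add: nonneg_scale affine.scale_right_diff_distrib)
  have "nonneg (affine_bracket (X - nonneg X) (Y - nonneg Y)) = 0 \<and> whit_char (affine_bracket (X - nonneg X) (Y - nonneg Y)) = 0"
  proof (induction X rule: affine_induct)
    case X: (loop x m)
    show ?case
    proof (induction Y rule: affine_induct)
      case (loop y n)
      then show ?case
        by (auto simp: nonneg_whit_char_simps)
    qed (auto simp only: add scale, auto simp: nonneg_whit_char_simps)
  qed (auto simp only: add scale, auto simp: nonneg_whit_char_simps)
  then show "nonneg (affine_bracket (X - nonneg X) (Y - nonneg Y)) = 0" "whit_char (affine_bracket (X - nonneg X) (Y - nonneg Y)) = 0"
    by auto
qed

section \<open>Derivations on words and the recursive functional\<close>

fun derivs :: "('a \<Rightarrow> 'a) \<Rightarrow> 'a list \<Rightarrow> 'a list list" where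
  "derivs D [] = []"
| "derivs D (X # w) = (D X # w) # map ((#) X) (derivs D w)"

lemma length_derivs: "w' \<in> set (derivs D w) \<Longrightarrow> length w' = length w"
  by (induction w arbitrary: w') auto

text \<open>
  A letter is split into its part in \<open>t\<^sup>-\<^sup>1sl(6)[t\<^sup>-\<^sup>1] \<oplus> \<complex>K\<close>, which acts on the left by the character,
  and its part in \<open>sl(6)[t] \<oplus> \<complex>d\<close>, which is commuted through the word and dies on the right.
\<close>

function whit :: "affine list \<Rightarrow> complex" where
  "whit [] = 1"
| "whit (X # w) = whit_char X * whit w + (\<Sum>u\<leftarrow>derivs (affine_bracket (nonneg X)) w. whit u)"
  by pat_completeness auto
termination by (relation "measures [length]") (auto dest: length_derivs)

text \<open>This is \<open>f\<close> composed with the derivation of the free algebra that extends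
  \<open>D\<close> by the Leibniz rule. \<open>f\<close> stays an argument because the recursion
  along the word prefixes letters to its input.\<close>

definition dersum :: "('a list \<Rightarrow> complex) \<Rightarrow> ('a \<Rightarrow> 'a) \<Rightarrow> 'a list \<Rightarrow> complex" where
  "dersum f D w = (\<Sum>u\<leftarrow>derivs D w. f u)"

lemma dersum_simps:
  "dersum f D [] = 0" "dersum f D (X # w) = f (D X # w) + dersum (\<lambda>u. f (X # u)) D w"
  by (simp_all add: dersum_def o_def)

lemma whit_Cons: "whit (X # w) = whit_char X * whit w + dersum whit (affine_bracket (nonneg X)) w"
  by (simp add: dersum_def)

declare whit.simps(2) [simp del]

lemma dersum_append: "dersum f D (u @ w) = dersum (\<lambda>u'. f (u' @ w)) D u + dersum (\<lambda>w'. f (u @ w')) D w"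
  by (induction u arbitrary: f) (simp_all add: dersum_simps)

lemma dersum_cong:
  assumes "\<And>u. length u = length w \<Longrightarrow> f u = g u"
  shows "dersum f D w = dersum g D w"
  unfolding dersum_def using assms length_derivs[of _ D w] by (intro arg_cong[of _ _ sum_list] map_cong) auto

lemma dersum_add: "dersum (\<lambda>u. f u + g u) D w = dersum f D w + dersum g D w"
  by (induction w arbitrary: f g) (simp_all add: dersum_simps)

lemma dersum_cmult:
  "dersum (\<lambda>u. c * f u) D w = c * dersum f D w" "dersum (\<lambda>u. f u * c) D w = dersum f D w * c"
  by (induction w arbitrary: f) (simp_all add: dersum_simps distrib_left distrib_right)

lemma dersum_zero: "dersum (\<lambda>u. 0) D w = 0"
  using dersum_cmult(1)[of 0 "\<lambda>u. 0" D w] by simp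

text \<open>The word length is fixed so that multilinearity of \<open>whit\<close> can be proved by
  induction on it: the recursion for \<open>whit\<close> passes to shorter words.\<close>

definition multilin :: "nat \<Rightarrow> (affine list \<Rightarrow> complex) \<Rightarrow> bool" where
  "multilin n f \<longleftrightarrow> (\<forall>u w X Y c. Suc (length u + length w) = n \<longrightarrow>
     f (u @ (affine_scale c X + Y) # w) = c * f (u @ X # w) + f (u @ Y # w))"

lemma multilinD:
  "multilin n f \<Longrightarrow> Suc (length u + length w) = n \<Longrightarrow>
     f (u @ (affine_scale c X + Y) # w) = c * f (u @ X # w) + f (u @ Y # w)"
  unfolding multilin_def by blast

lemma multilin_Cons:
  assumes "multilin (Suc n) f"
  shows "multilin n (\<lambda>u. f (X # u))"
  unfolding multilin_def
proof (intro allI impI)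
  fix u w :: "affine list" and Y Z c assume "Suc (length u + length w) = n"
  then show "f (X # u @ (affine_scale c Y + Z) # w) = c * f (X # u @ Y # w) + f (X # u @ Z # w)"
    using multilinD[OF assms, of "X # u" w c Y Z] by simp
qed

lemma dersum_linear:
  assumes "multilin (length w) f"
  shows "dersum f (\<lambda>Z. affine_scale c (D Z) + D' Z) w = c * dersum f D w + dersum f D' w"
  using assms
proof (induction w arbitrary: f)
  case (Cons X w)
  show ?case
    using Cons.IH[of "\<lambda>u. f (X # u)"] multilin_Cons[of "length w" f X] Cons.prems
      multilinD[OF Cons.prems, of "[]" w c "D X" "D' X"]
    by (simp add: dersum_simps algebra_simps)
qed (simp add: dersum_simps)

text \<open>Terms in which the two derivations hit different letters occur in both orders and
  cancel. What remains is the derivation induced by the commutator on single letters.\<close>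

lemma dersum_commutator:
  assumes "multilin (length w) f"
  shows "dersum (\<lambda>u. dersum f D' u) D w - dersum (\<lambda>u. dersum f D u) D' w =
    dersum f (\<lambda>Z. affine_scale (- 1) (D (D' Z)) + D' (D Z)) w"
  using assms
proof (induction w arbitrary: f)
  case (Cons X w)
  show ?case
    using Cons.IH[of "\<lambda>u. f (X # u)"] multilin_Cons[of "length w" f X] Cons.prems
      multilinD[OF Cons.prems, of "[]" w "- 1" "D (D' X)" "D' (D X)"]
    by (simp add: dersum_simps dersum_add algebra_simps)
qed (simp add: dersum_simps)

lemma multilin_whit: "multilin n whit"
proof (induction n rule: less_induct)
  case (less n)
  show ?case unfolding multilin_def
  proof (intro allI impI)
    fix u w :: "affine list" and X Y c assume n: "Suc (length u + length w) = n"
    show "whit (u @ (affine_scale c X + Y) # w) = c * whit (u @ X # w) + whit (u @ Y # w)"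
    proof (cases u)
      case Nil
      have "multilin (length w) whit" using n by (intro less) auto
      from dersum_linear[OF this, of c "affine_bracket (nonneg X)" "affine_bracket (nonneg Y)"] show ?thesis
        by (simp add: Nil whit_Cons whit_char_add whit_char_scale nonneg_add nonneg_scale distrib_right distrib_left
            affine_bracket_linear[abs_def] add.assoc add.left_commute)
    next
      case (Cons Z u')
      let ?D = "affine_bracket (nonneg Z)"
      have m: "multilin (n - 1) whit" using n by (intro less) (auto simp: Cons)
      have len: "Suc (length u' + length w) = n - 1" using n by (simp add: Cons)
      have 1: "dersum (\<lambda>v. whit (v @ (affine_scale c X + Y) # w)) ?D u' =
          c * dersum (\<lambda>v. whit (v @ X # w)) ?D u' + dersum (\<lambda>v. whit (v @ Y # w)) ?D u'"
        unfolding dersum_cmult(1)[symmetric] dersum_add[symmetric]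
        by (rule dersum_cong) (use len in \<open>auto intro!: multilinD[OF m]\<close>)
      have 2: "dersum (\<lambda>v. whit (u' @ (affine_scale c X + Y) # v)) ?D w =
          c * dersum (\<lambda>v. whit (u' @ X # v)) ?D w + dersum (\<lambda>v. whit (u' @ Y # v)) ?D w"
        unfolding dersum_cmult(1)[symmetric] dersum_add[symmetric]
        by (rule dersum_cong) (use len in \<open>auto intro!: multilinD[OF m]\<close>)
      show ?thesis
        by (simp add: Cons whit_Cons dersum_append dersum_simps affine_bracket_linear multilinD[OF m len] 1 2)
          (simp add: algebra_simps)
    qed
  qed
qed

lemma dersum_whit_zero: "dersum whit (affine_bracket 0) w = 0"
  using dersum_linear[OF multilin_whit, of 1 "affine_bracket 0" "affine_bracket 0" w]
  by (simp add: affine_bracket_zero(1)[abs_def])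

lemma whit_linear: "whit (u @ (affine_scale c X + Y) # w) = c * whit (u @ X # w) + whit (u @ Y # w)"
  by (rule multilinD[OF multilin_whit]) simp

lemma whit_add: "whit (u @ (X + Y) # w) = whit (u @ X # w) + whit (u @ Y # w)"
  using whit_linear[of u 1 X Y w] by (simp add: affine_scale_one)

lemma whit_zero: "whit (u @ 0 # w) = 0"
  using whit_add[of u 0 0 w] by simp

lemma whit_scale: "whit (u @ affine_scale c X # w) = c * whit (u @ X # w)"
  using whit_linear[of u c X 0 w] by (simp add: whit_zero)

lemma whit_diff: "whit (u @ (X - Y) # w) = whit (u @ X # w) - whit (u @ Y # w)"
  using whit_add[of u "X - Y" Y w] by simp

text \<open>The heart of the construction: the recursion, which always treats the leftmost letter,
  respects the commutator relation at every position of a word.\<close>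

lemma whit_commute: "whit (u @ X # Y # w) - whit (u @ Y # X # w) = whit (u @ affine_bracket X Y # w)"
proof (induction "length u + length w" arbitrary: u X Y w rule: less_induct)
  case less
  show ?case
  proof (cases u)
    case Nil
    let ?X = "nonneg X" and ?Y = "nonneg Y"
    have "affine_scale (- 1) (affine_bracket ?X (affine_bracket ?Y Z)) + affine_bracket ?Y (affine_bracket ?X Z)
        = affine_bracket (affine_bracket ?Y ?X) Z" for Z
      using affine_Jacobi[of ?Y ?X Z] by simp
    \<comment> \<open>The bracket of the nonnegative parts is again nonnegative with vanishing
      character, so prefixing it to \<open>w\<close> leaves only its derivation term.\<close>
    then have comm: "dersum (\<lambda>u. dersum whit (affine_bracket ?Y) u) (affine_bracket ?X) w
        - dersum (\<lambda>u. dersum whit (affine_bracket ?X) u) (affine_bracket ?Y) w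
        = whit (affine_bracket ?Y ?X # w)"
      using dersum_commutator[OF multilin_whit, where w = w and D = "affine_bracket ?X" and D' = "affine_bracket ?Y"]
      by (simp add: whit_Cons nonneg_subalgebra)
    \<comment> \<open>The last two summands together are the bracket of \<open>X - ?X\<close> with
      \<open>?Y\<close>. The terms with \<open>Y\<close> and \<open>X\<close> unsplit are those
      produced when a derivation hits the second letter of a word.\<close>
    have "affine_bracket X Y = affine_bracket (X - ?X) (Y - ?Y) + (affine_bracket ?X Y
        + (affine_bracket ?Y ?X - affine_bracket ?Y X))"
      using affine_bracket_add_left[of "X - ?X" ?X "Y - ?Y"] affine_bracket_add_right[of X "Y - ?Y" ?Y]
        affine_bracket_add_right[of ?X "Y - ?Y" ?Y]
      by (simp add: affine_bracket_swap[of ?Y] algebra_simps)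
    moreover have "whit (affine_bracket (X - ?X) (Y - ?Y) # w) = 0"
      by (simp add: whit_Cons neg_subalgebra dersum_whit_zero)
    ultimately have "whit (affine_bracket X Y # w) =
        whit (affine_bracket ?X Y # w) + whit (affine_bracket ?Y ?X # w) - whit (affine_bracket ?Y X # w)"
      using whit_add[of "[]"] whit_diff[of "[]"] by simp
    then show ?thesis
      using comm by (simp add: Nil whit_Cons dersum_simps dersum_add dersum_cmult algebra_simps)
  next
    case (Cons Z u')
    let ?D = "affine_bracket (nonneg Z)"
    \<comment> \<open>The letter \<open>Z\<close> either hits a letter of the context, where the
      induction hypothesis applies directly, or one of \<open>X\<close> and \<open>Y\<close>, where
      the Jacobi identity makes \<open>?D\<close> a derivation of the bracket.\<close>
    have IH: "whit (v @ X # Y # v') - whit (v @ Y # X # v') = whit (v @ affine_bracket X Y # v')"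
      if "length v + length v' = length u' + length w" for v v' X Y
      using less that by (simp add: Cons)
    have 1: "dersum (\<lambda>v. whit (v @ X # Y # w)) ?D u' =
        dersum (\<lambda>v. whit (v @ Y # X # w)) ?D u' + dersum (\<lambda>v. whit (v @ affine_bracket X Y # w)) ?D u'"
      unfolding dersum_add[symmetric]
      by (rule dersum_cong) (use IH[of _ w X Y] in \<open>simp add: algebra_simps\<close>)
    have 2: "dersum (\<lambda>v. whit (u' @ X # Y # v)) ?D w =
        dersum (\<lambda>v. whit (u' @ Y # X # v)) ?D w + dersum (\<lambda>v. whit (u' @ affine_bracket X Y # v)) ?D w"
      unfolding dersum_add[symmetric]
      by (rule dersum_cong) (use IH[of u' _ X Y] in \<open>simp add: algebra_simps\<close>)
    show ?thesis
      using IH[of u' w X Y] IH[of u' w "?D X" Y] IH[of u' w X "?D Y"] 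
      by (simp add: Cons whit_Cons dersum_append dersum_simps 1 2 affine_Jacobi[of "nonneg Z" X Y] whit_add algebra_simps)
  qed
qed

text \<open>Each letter to the left replaces \<open>b\<close> by a bracket with a nonnegative
  element, which has the same two properties. Hence \<open>b\<close> must vary in the induction; at
  the end only \<open>whit_char b\<close> is left.\<close>

lemma whit_right:
  assumes "nonneg b = b" "whit_char b = 0"
  shows "whit (u @ [b]) = 0"
  using assms
proof (induction "length u" arbitrary: u b rule: less_induct)
  case less
  show ?case
  proof (cases u)
    case (Cons X u')
    let ?D = "affine_bracket (nonneg X)"
    have "dersum (\<lambda>v. whit (v @ [b])) ?D u' = dersum (\<lambda>v. 0) ?D u'"
      by (rule dersum_cong) (use less in \<open>simp add: Cons\<close>)
    moreover have "whit (u' @ [?D b]) = 0"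
      by (rule less(1)) (use nonneg_subalgebra[of X b] less(2) in \<open>simp_all add: Cons\<close>)
    ultimately show ?thesis
      using less(1)[of u' b] less(2,3) by (simp add: Cons whit_Cons dersum_append dersum_simps dersum_zero)
  qed (simp add: whit_Cons dersum_simps less)
qed

lemma whit_right_central: "whit (u @ [central]) = level * whit u"
proof (induction "length u" arbitrary: u rule: less_induct)
  case less
  show ?case
  proof (cases u)
    case (Cons X u')
    let ?D = "affine_bracket (nonneg X)"
    have "dersum (\<lambda>v. whit (v @ [central])) ?D u' = dersum (\<lambda>v. level * whit v) ?D u'"
      by (rule dersum_cong) (use less in \<open>simp add: Cons\<close>)
    then show ?thesis
      using less whit_zero[of u' "[]"]
      by (simp add: Cons whit_Cons dersum_append dersum_simps dersum_cmult affine_bracket_gens algebra_simps)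
  qed (simp add: whit_Cons dersum_simps whit_char_central)
qed

section \<open>Descent of the functional to the enveloping algebra and the vacuum module\<close>

definition whit_free :: "free_algebra \<Rightarrow> complex" where
  "whit_free p = (\<Sum>w\<in>Poly_Mapping.keys p. Poly_Mapping.lookup p w * whit w)"

lemma whit_free_add: "whit_free (p + q) = whit_free p + whit_free q"
proof -
  let ?A = "Poly_Mapping.keys p \<union> Poly_Mapping.keys q"
  have *: "whit_free r = (\<Sum>w\<in>?A. Poly_Mapping.lookup r w * whit w)" if "Poly_Mapping.keys r \<subseteq> ?A" for r
    unfolding whit_free_def using that by (intro sum.mono_neutral_left) (auto simp: in_keys_iff)
  show ?thesis
    using keys_add[of p q] by (subst (1 2 3) *) (auto simp: lookup_add distrib_right sum.distrib)
qed

lemma whit_free_single: "whit_free (Poly_Mapping.single w c) = c * whit w"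
  by (simp add: whit_free_def)

lemma whit_free_zero: "whit_free 0 = 0"
  by (simp add: whit_free_def)

lemma whit_free_diff: "whit_free (p - q) = whit_free p - whit_free q"
  using whit_free_add[of "p - q" q] by simp

text \<open>Linearity and centrality of scalars reduce a two-sided multiple of a relator to one
  framed by two words, where the rules for \<open>whit\<close> apply.\<close>

lemma whit_free_ideal_gen:
  assumes "\<And>u w. whit_free (Poly_Mapping.single u 1 * r * Poly_Mapping.single w 1) = 0"
  shows "whit_free (a * r * b) = 0"
proof (induction a rule: poly_mapping_induct)
  case (add u c a)
  have "whit_free (Poly_Mapping.single u c * r * b) = 0"
  proof (induction b rule: poly_mapping_induct)
    case (add w d b)
    have "Poly_Mapping.single u c * r * Poly_Mapping.single w d
        = Poly_Mapping.single [] (c * d) * (Poly_Mapping.single u 1 * r * Poly_Mapping.single w 1)"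
    proof -
      have "Poly_Mapping.single u c = free_const c * Poly_Mapping.single u 1"
        "Poly_Mapping.single w d = free_const d * Poly_Mapping.single w 1"
        by (simp_all add: free_const_def mult_single plus_list_def)
      then have "Poly_Mapping.single u c * r * Poly_Mapping.single w d
          = free_const c * (Poly_Mapping.single u 1 * r * free_const d) * Poly_Mapping.single w 1"
        by (simp add: mult.assoc)
      also have "Poly_Mapping.single u 1 * r * free_const d = free_const d * (Poly_Mapping.single u 1 * r)"
        by (rule free_const_comm)
      finally show ?thesis
        by (simp only: free_const_def[symmetric] free_const_mult mult.assoc)
    qed
    moreover have "whit_free (Poly_Mapping.single [] k * p) = k * whit_free p" for k p
      by (induction p rule: poly_mapping_induct)
        (simp_all add: distrib_left whit_free_add mult_single plus_list_def whit_free_single whit_free_zero)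
    ultimately show ?case using add assms by (simp add: distrib_left whit_free_add)
  qed (simp add: whit_free_zero)
  with add show ?case by (simp add: distrib_right whit_free_add)
qed (simp add: whit_free_zero)

lemma whit_free_uea_ideal: "r \<in> uea_ideal \<Longrightarrow> whit_free (a * r * b) = 0"
proof (induction arbitrary: a b rule: uea_ideal.induct)
  case (relator r)
  show ?case
  proof (rule whit_free_ideal_gen)
    fix u w
    consider X Y where "r = free_gen (X + Y) - free_gen X - free_gen Y"
      | c X where "r = free_gen (affine_scale c X) - free_const c * free_gen X"
      | X Y where "r = free_gen X * free_gen Y - free_gen Y * free_gen X - free_gen (affine_bracket X Y)"
      using relator unfolding uea_relators_def by blast
    then show "whit_free (Poly_Mapping.single u 1 * r * Poly_Mapping.single w 1) = 0"
    proof cases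
      case 1
      then show ?thesis
        by (simp add: free_gen_def left_diff_distrib right_diff_distrib mult_single plus_list_def
            whit_free_diff whit_free_single whit_add)
    next
      case 2
      then show ?thesis
        by (simp add: free_gen_def free_const_def left_diff_distrib right_diff_distrib mult_single
            plus_list_def whit_free_diff whit_free_single whit_scale)
    next
      case (3 X Y)
      then show ?thesis
        using whit_commute[of u X Y w]
        by (simp add: free_gen_def left_diff_distrib right_diff_distrib mult_single plus_list_def
            whit_free_diff whit_free_single)
    qed
  qed
next
  case (left u w)
  then show ?case using left(2)[of "a * w" b] by (simp add: mult.assoc)
next
  case (right u w)
  then show ?case using right(2)[of a "w * b"] by (simp add: mult.assoc)
qed (simp_all add: whit_free_zero distrib_left distrib_right whit_free_add)

lift_definition whit_uea :: "uea \<Rightarrow> complex" is whit_free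
proof -
  fix p q :: free_algebra assume "p - q \<in> uea_ideal"
  from whit_free_uea_ideal[OF this, of 1 1] show "whit_free p = whit_free q"
    by (simp add: whit_free_diff)
qed

lemma whit_uea_add: "whit_uea (u + w) = whit_uea u + whit_uea w"
  by transfer (rule whit_free_add)

lemma whit_uea_scale: "whit_uea (c \<cdot> u) = c * whit_uea u"
proof (transfer, goal_cases)
  case (1 c u)
  show ?case
    by (induction u rule: poly_mapping_induct)
      (simp_all add: distrib_left whit_free_add mult_single plus_list_def whit_free_single whit_free_zero free_const_def)
qed

lemma whit_uea_diff: "whit_uea (u - w) = whit_uea u - whit_uea w"
  by transfer (rule whit_free_diff)

lemma uea_word_eq: "prod_list (map uea_gen w) = abs_uea (Poly_Mapping.single w 1)"
proof (induction w)
  case Nil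
  have "(1 :: free_algebra) = Poly_Mapping.single [] 1"
    using free_const_one by (simp add: free_const_def)
  then show ?case by (simp only: one_uea.abs_eq list.map prod_list.Nil)
next
  case (Cons X w)
  have "Poly_Mapping.single (X # w) 1 = free_gen X * Poly_Mapping.single w (1 :: complex)"
    by (simp add: free_gen_def mult_single plus_list_def)
  with Cons show ?case by (simp only: list.map prod_list.Cons uea_gen.abs_eq times_uea.abs_eq)
qed

lemma uea_word_induct [case_names word add scale]:
  assumes "\<And>w. P (prod_list (map uea_gen w))" "\<And>u w. P u \<Longrightarrow> P w \<Longrightarrow> P (u + w)"
    "\<And>c u. P u \<Longrightarrow> P (c \<cdot> u)"
  shows "P u"
proof -
  have "P (abs_uea p)" for p
  proof (induction p rule: poly_mapping_induct)
    case zero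
    show ?case using assms(3)[OF assms(1), of 0 "[]"] by (simp only: uea.scale_zero_left zero_uea.abs_eq)
  next
    case (add k c p)
    have "Poly_Mapping.single k c = free_const c * Poly_Mapping.single k 1"
      by (simp add: free_const_def mult_single plus_list_def)
    then have "abs_uea (Poly_Mapping.single k c + p) = c \<cdot> prod_list (map uea_gen k) + abs_uea p"
      by (simp only: uea_word_eq plus_uea.abs_eq uea_scale.abs_eq)
    with add assms show ?case by simp
  qed
  then show ?thesis by (rule uea.abs_induct)
qed

lemma whit_uea_word: "whit_uea (prod_list (map uea_gen w)) = whit w"
  by (simp only: uea_word_eq whit_uea.abs_eq whit_free_single mult_1)

text \<open>The arbitrary left factor makes closure under left multiplication immediate. Among the
  generators only \<open>K\<close> has a nonzero character and is treated apart.\<close>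

lemma whit_uea_vacuum_ideal:
  assumes "u \<in> vacuum_ideal level"
  shows "whit_uea (w * u) = 0"
proof -
  have gen: "whit_uea (w * uea_gen b) = 0" if "nonneg b = b" "whit_char b = 0" for w b
  proof (induction w rule: uea_word_induct)
    case (word w)
    show ?case using whit_uea_word[of "w @ [b]"] whit_right[OF that, of w] by simp
  qed (simp_all add: distrib_right whit_uea_add uea_scale_mult_left whit_uea_scale)
  from assms show ?thesis
  proof (induction arbitrary: w rule: vacuum_ideal.induct)
    case central
    show ?case
    proof (induction w rule: uea_word_induct)
      case (word w)
      show ?case
        using whit_uea_word[of "w @ [central]"] whit_uea_word[of w] whit_right_central[of w]
        by (simp add: right_diff_distrib whit_uea_diff uea_scale_mult_right whit_uea_scale)
    qed (simp_all add: distrib_right whit_uea_add uea_scale_mult_left whit_uea_scale)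
  next
    case zero
    show ?case using whit_uea_scale[of 0 0] by simp
  qed (simp_all add: gen mode_def nonneg_loop whit_char_loop nonneg_derivation whit_char_derivation
      distrib_left whit_uea_add mult.assoc[symmetric])
qed

text \<open>A negative mode has no nonnegative part, so the derivation terms drop out of the
  recursion and no reordering is involved.\<close>

lemma whit_uea_modes:
  assumes "\<forall>(x, m) \<in> set w. m < 0"
  shows "whit_uea (prod_list (map (\<lambda>(x, m). mode x m) w)) = (\<Prod>(x, m)\<leftarrow>w. whit_char (loop x m))"
proof -
  have "whit (map (\<lambda>(x, m). loop x m) w) = (\<Prod>(x, m)\<leftarrow>w. whit_char (loop x m))"
    using assms
  proof (induction w)
    case (Cons p w)
    obtain x m where "p = (x, m)" by (cases p)
    with Cons show ?case
      by (simp add: whit_Cons nonneg_loop dersum_whit_zero)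
  qed simp
  moreover have "map (\<lambda>(x, m). mode x m) w = map uea_gen (map (\<lambda>(x, m). loop x m) w)"
    by (auto simp: mode_def)
  ultimately show ?thesis by (simp only: whit_uea_word)
qed

section \<open>Brackets of matrix units and coroots\<close>

lemma of_nat_6_eq_iff:
  assumes "1 \<le> i" "i \<le> 6" "1 \<le> j" "j \<le> 6"
  shows "(of_nat i :: 6) = of_nat j \<longleftrightarrow> i = j"
proof -
  have "i \<in> {1, 2, 3, 4, 5, 6}" "j \<in> {1, 2, 3, 4, 5, 6}" using assms by auto
  then show ?thesis by auto
qed

lemma UNIV_6: "(UNIV :: 6 set) = of_nat ` {1..6}"
proof -
  have "inj_on (of_nat :: nat \<Rightarrow> 6) {1..6}"
    by (rule inj_onI) (simp add: of_nat_6_eq_iff)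
  then have "card (of_nat ` {1..6} :: 6 set) = CARD(6)" by (simp add: card_image)
  then show ?thesis by (intro card_subset_eq[symmetric]) auto
qed

lemma matrix_unit_mult:
  assumes "j \<in> {1..6}" "k \<in> {1..6}"
  shows "matrix_unit i j ** matrix_unit k l = (if j = k then matrix_unit i l else 0)"
proof -
  have "(matrix_unit i j ** matrix_unit k l) $ a $ b = (if j = k then matrix_unit i l else 0) $ a $ b" for a b
  proof -
    have "(matrix_unit i j ** matrix_unit k l) $ a $ b
        = (\<Sum>c\<in>(UNIV :: 6 set). if c = of_nat j then (if a = of_nat i \<and> of_nat j = (of_nat k :: 6) \<and> b = of_nat l then 1 else 0) else 0)"
      unfolding matrix_matrix_mult_def matrix_unit_def by (simp only: vec_lambda_beta) (rule sum.cong[OF refl], auto)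
    also have "\<dots> = (if a = of_nat i \<and> of_nat j = (of_nat k :: 6) \<and> b = of_nat l then 1 else 0)"
      by (simp only: sum.delta[OF finite] UNIV_I if_True)
    finally show ?thesis using assms by (auto simp: of_nat_6_eq_iff matrix_unit_def)
  qed
  then show ?thesis by (simp add: vec_eq_iff)
qed

lemma Rep_sl_unit:
  assumes "i \<in> {1..6}" "j \<in> {1..6}" "i \<noteq> j"
  shows "Rep_sl6 (sl_unit i j) = matrix_unit i j"
  using assms by (auto simp: sl_unit.rep_eq of_nat_6_eq_iff)

lemma sl_bracket_unit_unit:
  assumes "i \<in> {1..6}" "j \<in> {1..6}" "l \<in> {1..6}" "i \<noteq> j" "j \<noteq> l" "i \<noteq> l"
  shows "sl_bracket (sl_unit i j) (sl_unit j l) = sl_unit i l"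
  using assms
  by (intro sl6_eqI) (simp add: sl_bracket.rep_eq Rep_sl_unit matrix_unit_mult)

lemma coroot_telescope:
  assumes "i < j"
  shows "Rep_sl6 (\<Sum>l\<in>{i..<j}. coroot l) = matrix_unit i i - matrix_unit j j"
  using assms
proof (induction j)
  case (Suc j)
  then show ?case
    by (cases "i = j") (simp_all add: Rep_sl6_simps coroot.rep_eq)
qed simp

text \<open>
  A letter \<open>(i, j, m)\<close> with \<open>i \<noteq> j\<close> encodes the mode \<open>m\<close> of a matrix unit, and \<open>(i, i, m)\<close> that of the
  \<open>i\<close>-th coroot.
\<close>

type_synonym letter = "int \<times> int \<times> int"
type_synonym comb = "(int \<times> letter list) list"

definition sl_letter :: "int \<Rightarrow> int \<Rightarrow> sl6" where
  "sl_letter i j = (if i = j then coroot (nat i) else sl_unit (nat i) (nat j))"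

definition valid :: "int \<Rightarrow> int \<Rightarrow> bool" where
  "valid i j \<longleftrightarrow> 1 \<le> i \<and> i \<le> 6 \<and> 1 \<le> j \<and> j \<le> 6 \<and> (i = j \<longrightarrow> i \<le> 5)"

definition kronecker :: "int \<Rightarrow> int \<Rightarrow> int" where "kronecker i j = (if i = j then 1 else 0)"

text \<open>The result is a list because \<open>E_ij\<close> and \<open>E_ji\<close> bracket to
  \<open>E_ii - E_jj\<close>, the telescoping sum of the simple coroots between the indices, negated
  if \<open>i > j\<close>.\<close>

definition letter_bracket :: "int \<Rightarrow> int \<Rightarrow> int \<Rightarrow> int \<Rightarrow> (int \<times> int \<times> int) list" where
  "letter_bracket i j k l =
    (if i = j then
       (if k = l then [] else [(kronecker i k - kronecker (i + 1) k - kronecker i l + kronecker (i + 1) l, k, l)])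
     else if k = l then [(kronecker k j - kronecker (k + 1) j - kronecker k i + kronecker (k + 1) i, i, j)]
     else if j = k then
       (if i = l then
          (if i < j then map (\<lambda>r. (1, r, r)) [i..j - 1] else map (\<lambda>r. (- 1, r, r)) [j..i - 1])
        else [(1, i, l)])
     else if i = l then [(- 1, k, j)] else [])"

text \<open>On coroots this is the Cartan matrix of type \<open>A_5\<close>.\<close>

definition letter_form :: "int \<Rightarrow> int \<Rightarrow> int \<Rightarrow> int \<Rightarrow> int" where
  "letter_form i j k l =
    (if i = j then if k = l then 2 * kronecker i k - kronecker (i + 1) k - kronecker i (k + 1) else 0
     else kronecker i l * kronecker j k)"

abbreviation munit :: "int \<Rightarrow> int \<Rightarrow> complex^6^6" where "munit i j \<equiv> matrix_unit (nat i) (nat j)"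

lemma munit_mult:
  assumes "1 \<le> j" "j \<le> 6" "1 \<le> k" "k \<le> 6"
  shows "munit i j ** munit k l = (if j = k then munit i l else 0)"
  using assms by (subst matrix_unit_mult) (auto simp: nat_le_iff)

lemma Rep_sl_letter:
  assumes "valid i j"
  shows "Rep_sl6 (sl_letter i j) = (if i = j then munit i i - munit (i + 1) (i + 1) else munit i j)"
proof (cases "i = j")
  case True
  then show ?thesis using assms by (simp add: valid_def sl_letter_def coroot.rep_eq nat_add_distrib)
next
  case False
  then have "nat i \<in> {1..6}" "nat j \<in> {1..6}" "nat i \<noteq> nat j" using assms by (auto simp: valid_def)
  from Rep_sl_unit[OF this] False show ?thesis by (simp add: sl_letter_def)
qed

lemma coroot_sum_letters:
  assumes "1 \<le> i" "i < j"
  shows "Rep_sl6 (\<Sum>r\<leftarrow>[i..j - 1]. sl_letter r r) = munit i i - munit j j"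
proof -
  have "(\<Sum>r\<leftarrow>[i..j - 1]. sl_letter r r) = (\<Sum>r\<in>{i..j - 1}. sl_letter r r)"
    by (simp add: sum_list_distinct_conv_sum_set)
  also have "\<dots> = (\<Sum>l\<in>{nat i..<nat j}. coroot l)"
    by (rule sum.reindex_bij_witness[of _ int nat]) (use assms in \<open>auto simp: sl_letter_def\<close>)
  finally show ?thesis using coroot_telescope[of "nat i" "nat j"] assms by simp
qed

lemma sl_scale_sum_list: "sl_scale c (sum_list xs) = (\<Sum>x\<leftarrow>xs. sl_scale c x)"
  by (induction xs) (simp_all add: sl6.scale_right_distrib)

lemma sl_bracket_letters:
  assumes "valid i j" "valid k l"
  shows "sl_bracket (sl_letter i j) (sl_letter k l) =
    (\<Sum>(c, r, s)\<leftarrow>letter_bracket i j k l. sl_scale (of_int c) (sl_letter r s))"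
proof -
  note R = sl_bracket.rep_eq Rep_sl_letter[OF assms(1)] Rep_sl_letter[OF assms(2)]
  have v: "1 \<le> i" "i \<le> 6" "1 \<le> j" "j \<le> 6" "1 \<le> k" "k \<le> 6" "1 \<le> l" "l \<le> 6"
    "i = j \<Longrightarrow> i + 1 \<le> 6" "k = l \<Longrightarrow> k + 1 \<le> 6" using assms by (auto simp: valid_def)
  have M: "munit a b ** munit c d = (if b = c then munit a d else 0)"
    if "b \<in> {i, j, k, l} \<or> b = i + 1 \<and> i = j \<or> b = k + 1 \<and> k = l"
      "c \<in> {i, j, k, l} \<or> c = i + 1 \<and> i = j \<or> c = k + 1 \<and> k = l" for a b c d
    using that v by (intro munit_mult) auto
  consider "i = j" "k = l" | "i = j" "k \<noteq> l" | "i \<noteq> j" "k = l" | "i \<noteq> j" "k \<noteq> l" "j = k" "i = l" "i < j"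
    | "i \<noteq> j" "k \<noteq> l" "j = k" "i = l" "j < i" | "i \<noteq> j" "k \<noteq> l" "j \<noteq> k \<or> i \<noteq> l" by fastforce
  then show ?thesis
  proof cases
    case 1
    then show ?thesis
      by (intro sl6_eqI) (unfold R, simp add: letter_bracket_def Rep_sl6_simps matrix_mult_distrib M)
  next
    case 2
    then show ?thesis using assms(2)
      by (intro sl6_eqI) (unfold R, simp add: letter_bracket_def Rep_sl6_simps matrix_mult_distrib M kronecker_def Rep_sl_letter)
  next
    case 3
    then show ?thesis using assms(1)
      by (intro sl6_eqI) (unfold R, simp add: letter_bracket_def Rep_sl6_simps matrix_mult_distrib M kronecker_def Rep_sl_letter)
  next
    case 4
    then show ?thesis
      using coroot_sum_letters[of i j] v
      by (intro sl6_eqI) (unfold R, simp add: letter_bracket_def M o_def case_prod_beta)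
  next
    case 5
    have "sl_bracket (sl_letter i j) (sl_letter k l) = - (\<Sum>r\<leftarrow>[j..i - 1]. sl_letter r r)"
      using coroot_sum_letters[of j i] v 5
      by (intro sl6_eqI) (unfold R, simp add: M Rep_sl6_simps)
    moreover have "(\<Sum>r\<leftarrow>[j..i - 1]. sl_scale (- 1) (sl_letter r r)) = - (\<Sum>r\<leftarrow>[j..i - 1]. sl_letter r r)"
      using sl_scale_sum_list[of "- 1" "map (\<lambda>r. sl_letter r r) [j..i - 1]"] by (simp add: o_def)
    ultimately show ?thesis using 5 by (simp add: letter_bracket_def o_def)
  next
    case 6
    have "valid i l" if "j = k" using assms 6 that by (auto simp: valid_def)
    moreover have "valid k j" if "i = l" using assms 6 that by (auto simp: valid_def)
    ultimately show ?thesis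
      using 6 by (intro sl6_eqI) (unfold R, auto simp: letter_bracket_def M Rep_sl6_simps Rep_sl_letter)
  qed
qed

lemma trace_munit:
  assumes "1 \<le> i" "i \<le> 6" "1 \<le> j" "j \<le> 6"
  shows "trace (munit i j) = of_int (kronecker i j)"
  using assms unfolding trace_matrix_unit kronecker_def by (subst of_nat_6_eq_iff) auto

lemma sl_form_letters:
  assumes "valid i j" "valid k l"
  shows "sl_form (sl_letter i j) (sl_letter k l) = of_int (letter_form i j k l)"
proof -
  note R = sl_form.rep_eq Rep_sl_letter[OF assms(1)] Rep_sl_letter[OF assms(2)]
  have v: "1 \<le> i" "i \<le> 6" "1 \<le> j" "j \<le> 6" "1 \<le> k" "k \<le> 6" "1 \<le> l" "l \<le> 6"
    "i = j \<Longrightarrow> i \<le> 5" "k = l \<Longrightarrow> k \<le> 5" using assms by (auto simp: valid_def)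
  have t0: "trace (0 :: complex^6^6) = 0" by (simp add: trace_def)
  show ?thesis
    unfolding R using v
    by (cases "i = j"; cases "k = l")
      (auto simp: letter_form_def matrix_mult_distrib munit_mult trace_sub trace_munit t0 kronecker_def)
qed

section \<open>Computing in the vacuum module\<close>

text \<open>With the factor 2 the half-integral level contributes only integral coefficients.\<close>

definition letter :: "letter \<Rightarrow> uea" where
  "letter X = (case X of (i, j, m) \<Rightarrow> 2 \<cdot> mode (sl_letter i j) m)"

definition word :: "letter list \<Rightarrow> uea" where
  "word w = prod_list (map letter w)"

lemma word_simps: "word [] = 1" "word (X # w) = letter X * word w" "word (u @ w) = word u * word w"
  by (simp_all add: word_def)

lemma act_scale_right: "u \<odot> vac_scale c v = vac_scale c (u \<odot> v)"
proof -
  have "u * (c \<cdot> 1) = (c \<cdot> 1) * u" by (simp add: uea_scale_mult_left uea_scale_mult_right)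
  then show ?thesis by (simp add: vac_scale_def act_mult[symmetric])
qed

lemma act_one: "1 \<odot> v = v"
  by (induct v rule: vac_module.abs_induct) (simp add: act_abs)

global_interpretation vac: vector_space vac_scale
proof
  fix c d v w
  show "vac_scale c (v + w) = vac_scale c v + vac_scale c w"
    by (simp add: vac_scale_def act_add_right)
  show "vac_scale (c + d) v = vac_scale c v + vac_scale d v"
    by (simp add: vac_scale_def act_add_left uea_scale_add_left)
  show "vac_scale c (vac_scale d v) = vac_scale (c * d) v"
    by (simp add: vac_scale_def act_mult[symmetric] uea_scale_mult_left uea_scale_scale)
  show "vac_scale 1 v = v"
    by (simp add: vac_scale_def act_one)
qed

section \<open>Integer combinations of words and their reordering\<close>

definition comb_vec :: "comb \<Rightarrow> vac_module" where
  "comb_vec p = (\<Sum>(c, w)\<leftarrow>p. vac_scale (of_int c) (word w \<odot> vacuum))"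

lemma comb_vec_simps: "comb_vec [] = 0" "comb_vec ((c, w) # p) = vac_scale (of_int c) (word w \<odot> vacuum) + comb_vec p"
  "comb_vec (p @ q) = comb_vec p + comb_vec q"
  by (simp_all add: comb_vec_def)

definition comb_scale :: "int \<Rightarrow> comb \<Rightarrow> comb" where
  "comb_scale c p = map (\<lambda>(d, w). (c * d, w)) p"

lemma comb_vec_comb_scale: "comb_vec (comb_scale c p) = vac_scale (of_int c) (comb_vec p)"
  by (induction p) (auto simp: comb_scale_def comb_vec_simps vac.scale_right_distrib)

definition extend :: "(letter list \<Rightarrow> comb) \<Rightarrow> comb \<Rightarrow> comb" where
  "extend f p = concat (map (\<lambda>(c, u). comb_scale c (f u)) p)"

lemma comb_vec_extend:
  assumes "\<And>u. comb_vec (f u) = A \<odot> word u \<odot> vacuum"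
  shows "comb_vec (extend f p) = A \<odot> comb_vec p"
  by (induction p)
    (auto simp: extend_def comb_vec_simps comb_vec_comb_scale assms act_zero_right act_add_right act_scale_right)

text \<open>The mode is compared first: the bracket of two negative modes lies below both and so
  belongs further to the left.\<close>

fun letter_le :: "letter \<Rightarrow> letter \<Rightarrow> bool" where
  "letter_le (i, j, m) (k, l, n) \<longleftrightarrow> m < n \<or> m = n \<and> (i < k \<or> i = k \<and> j \<le> l)"

text \<open>
  The first argument bounds the recursion; when it runs out, the word is left unsorted, which is harmless.
\<close>

fun apply_letter :: "nat \<Rightarrow> letter \<Rightarrow> letter list \<Rightarrow> comb" where
  "apply_letter 0 X w = [(1, X # w)]"
| "apply_letter (Suc f) (i, j, m) [] = (if 0 \<le> m then [] else [(1, [(i, j, m)])])"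
| "apply_letter (Suc f) (i, j, m) ((k, l, n) # w) =
     (if m < 0 \<and> letter_le (i, j, m) (k, l, n) \<or> \<not> (valid i j \<and> valid k l) then [(1, (i, j, m) # (k, l, n) # w)]
      else extend (apply_letter f (k, l, n)) (apply_letter f (i, j, m) w)
        @ concat (map (\<lambda>(c, r, s). comb_scale (2 * c) (apply_letter f (r, s, m + n) w)) (letter_bracket i j k l))
        @ (if m + n = 0 then [(- 14 * m * letter_form i j k l, w)] else []))"

lemma central_word: "uea_gen central * word w = word w * uea_gen central"
proof (induction w)
  case (Cons X w)
  obtain i j m where X: "X = (i, j, m)" by (cases X)
  have "uea_gen central * letter X = letter X * uea_gen central"
    by (simp add: letter_def X mode_def uea_scale_mult_left uea_scale_mult_right central_commute)
  then show ?case using Cons by (metis word_simps(2) mult.assoc)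
qed (simp add: word_simps)

lemma central_word_vacuum: "uea_gen central \<odot> word w \<odot> vacuum = vac_scale level (word w \<odot> vacuum)"
  by (simp add: act_mult[symmetric] central_word) (simp add: act_mult central_vacuum act_scale_right)

lemma mode_sum_list: "mode (\<Sum>x\<leftarrow>xs. f x) m = (\<Sum>x\<leftarrow>xs. mode (f x) m)"
  by (induction xs) (simp_all add: mode_add mode_zero)

lemma act_sum_list: "(\<Sum>x\<leftarrow>xs. f x) \<odot> v = (\<Sum>x\<leftarrow>xs. f x \<odot> v)"
  by (induction xs) (simp_all add: act_add_left act_zero_left)

lemma vac_scale_sum_list: "vac_scale c (\<Sum>x\<leftarrow>xs. f x) = (\<Sum>x\<leftarrow>xs. vac_scale c (f x))"
  by (induction xs) (simp_all add: vac.scale_right_distrib)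

lemma letter_act: "letter (i, j, m) \<odot> v = vac_scale 2 (mode (sl_letter i j) m \<odot> v)"
  by (simp add: letter_def act_scale)

text \<open>Two doubled letters give a factor 4. The doubled letter of the bracket absorbs half of
  it, which leaves 2; the central term keeps all of it, and 4 times the level is -14.\<close>

lemma letter_commute:
  assumes "valid i j" "valid k l"
  shows "letter (i, j, m) \<odot> letter (k, l, n) \<odot> word w \<odot> vacuum =
     letter (k, l, n) \<odot> letter (i, j, m) \<odot> word w \<odot> vacuum
     + (\<Sum>(c, r, s)\<leftarrow>letter_bracket i j k l. vac_scale (of_int (2 * c)) (letter (r, s, m + n) \<odot> word w \<odot> vacuum))
     + (if m + n = 0 then vac_scale (of_int (- 14 * m * letter_form i j k l)) (word w \<odot> vacuum) else 0)"
proof -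
  let ?x = "sl_letter i j" and ?y = "sl_letter k l" and ?v = "word w \<odot> vacuum"
  have "mode ?x m \<odot> mode ?y n \<odot> ?v = mode ?y n \<odot> mode ?x m \<odot> ?v + mode (sl_bracket ?x ?y) (m + n) \<odot> ?v
      + vac_scale (if m + n = 0 then of_int m * sl_form ?x ?y else 0) (uea_gen central \<odot> ?v)"
    unfolding act_mult[of "mode ?x m", symmetric] mode_commute[of ?x m ?y n]
    by (simp only: act_mult act_add_left act_scale)
  moreover have "mode (sl_bracket ?x ?y) (m + n) \<odot> ?v =
      (\<Sum>(c, r, s)\<leftarrow>letter_bracket i j k l. vac_scale (of_int c) (mode (sl_letter r s) (m + n) \<odot> ?v))"
    unfolding sl_bracket_letters[OF assms] mode_sum_list act_sum_list
    by (simp add: case_prod_unfold mode_scale act_scale)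
  ultimately show ?thesis
    by (simp add: letter_act act_scale_right vac.scale_right_distrib vac.scale_right_diff_distrib
        central_word_vacuum sl_form_letters[OF assms] level_def vac_scale_sum_list case_prod_unfold)
qed

text \<open>No hypothesis on fuel or letters arises, because in the exceptional cases the word is
  returned with the letter merely prefixed.\<close>

lemma comb_vec_apply_letter: "comb_vec (apply_letter n X w) = letter X \<odot> word w \<odot> vacuum"
proof (induction n X w rule: apply_letter.induct)
  case (2 f i j m)
  then show ?case
    by (simp add: comb_vec_simps word_simps act_mult act_one letter_act nonneg_mode_vacuum)
next
  case (3 f i j m k l n w)
  show ?case
  proof (cases "m < 0 \<and> letter_le (i, j, m) (k, l, n) \<or> \<not> (valid i j \<and> valid k l)")
    case True
    then show ?thesis by (simp add: comb_vec_simps word_simps act_mult)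
  next
    case False
    have 1: "comb_vec (extend (apply_letter f (k, l, n)) (apply_letter f (i, j, m) w)) =
        letter (k, l, n) \<odot> letter (i, j, m) \<odot> word w \<odot> vacuum"
      using 3(1,2)[OF False] by (simp add: comb_vec_extend)
    \<comment> \<open>Generalized to parts of the bracket for the list induction; the hypothesis on
      \<open>apply_letter\<close> is available only for summands of this bracket.\<close>
    have 2: "comb_vec (concat (map (\<lambda>(c, r, s). comb_scale (2 * c) (apply_letter f (r, s, m + n) w)) bs)) =
        (\<Sum>(c, r, s)\<leftarrow>bs. vac_scale (of_int (2 * c)) (letter (r, s, m + n) \<odot> word w \<odot> vacuum))"
      if "set bs \<subseteq> set (letter_bracket i j k l)" for bs
      using that 3(3)[OF False]
      by (induction bs) (auto simp: comb_vec_simps comb_vec_comb_scale)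
    show ?thesis
      unfolding apply_letter.simps if_not_P[OF False]
      using False letter_commute[of i j k l m n w] 2[OF subset_refl]
      by (auto simp: comb_vec_simps 1 word_simps act_mult)
  qed
qed (simp add: comb_vec_simps word_simps act_mult)

section \<open>Generation by the simple root vectors and the affine one\<close>

lemma Rep_sl6_sum: "Rep_sl6 (sum f A) $ a $ b = (\<Sum>i\<in>A. Rep_sl6 (f i) $ a $ b)"
  by (induction A rule: infinite_finite_induct) (simp_all add: Rep_sl6_simps)

lemma index_6_cases:
  obtains p where "p \<in> {1..6}" "(a :: 6) = of_nat p"
proof -
  have "a \<in> of_nat ` {1..6}" by (metis UNIV_6 UNIV_I)
  then show ?thesis using that by blast
qed

lemma sum_UNIV_6: "(\<Sum>a\<in>(UNIV :: 6 set). f a) = (\<Sum>p = 1..6. f (of_nat p))"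
  unfolding UNIV_6 by (subst sum.reindex) (auto intro!: inj_onI simp: of_nat_6_eq_iff)

lemma sum_diag_sl6: "(\<Sum>p = 1..6. Rep_sl6 x $ of_nat p $ of_nat p) = 0"
  using Rep_sl6[of x] by (simp add: trace_def sum_UNIV_6)

text \<open>The diagonal entries are differences of consecutive coroot coefficients, so these
  coefficients are partial sums of the diagonal; the last entry comes out right because the trace is
  zero. Diagonal indices are harmless in the double sum since \<open>sl_unit i i\<close> is
  0.\<close>

lemma sl6_decomposition:
  "x = (\<Sum>i = 1..6. \<Sum>j = 1..6. sl_scale (Rep_sl6 x $ of_nat i $ of_nat j) (sl_unit i j))
     + (\<Sum>i = 1..5. sl_scale (\<Sum>p = 1..i. Rep_sl6 x $ of_nat p $ of_nat p) (coroot i))"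
  (is "x = ?U + ?D")
proof (rule sl6_eqI)
  fix a b :: 6
  obtain p where p: "p \<in> {1..6}" "a = of_nat p" by (rule index_6_cases)
  obtain q where q: "q \<in> {1..6}" "b = of_nat q" by (rule index_6_cases)
  let ?x = "\<lambda>i j. Rep_sl6 x $ of_nat i $ of_nat j"
  have "Rep_sl6 ?U $ a $ b = (\<Sum>i = 1..6. \<Sum>j = 1..6. ?x i j * Rep_sl6 (sl_unit i j) $ of_nat p $ of_nat q)"
    by (simp add: Rep_sl6_sum Rep_sl6_simps p q)
  also have "\<dots> = (\<Sum>i = 1..6. if i = p then (\<Sum>j = 1..6. if j = q then (if p = q then 0 else ?x p q) else 0) else 0)"
  proof (rule sum.cong[OF refl])
    fix i :: nat assume i: "i \<in> {1..6}"
    have "?x i j * Rep_sl6 (sl_unit i j) $ of_nat p $ of_nat q =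
        (if i = p \<and> j = q \<and> p \<noteq> q then ?x p q else 0)" if "j \<in> {1..6}" for j
      using i that p q by (auto simp: sl_unit.rep_eq matrix_unit_def of_nat_6_eq_iff)
    then show "(\<Sum>j = 1..6. ?x i j * Rep_sl6 (sl_unit i j) $ of_nat p $ of_nat q) =
        (if i = p then (\<Sum>j = 1..6. if j = q then (if p = q then 0 else ?x p q) else 0) else 0)"
      by (auto intro!: sum.cong sum.neutral)
  qed
  also have "\<dots> = (if p = q then 0 else ?x p q)"
    using p q by (simp add: sum.delta)
  finally have U: "Rep_sl6 ?U $ a $ b = (if p = q then 0 else ?x p q)" .
  have "Rep_sl6 ?D $ a $ b = (\<Sum>i = 1..5. (\<Sum>r = 1..i. ?x r r) *
      (matrix_unit i i $ a $ b - matrix_unit (i + 1) (i + 1) $ a $ b))"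
    by (simp add: Rep_sl6_sum Rep_sl6_simps coroot.rep_eq)
  also have "\<dots> = (\<Sum>i = 1..5. (\<Sum>r = 1..i. ?x r r) * ((if p = i \<and> q = i then 1 else 0) - (if p = i + 1 \<and> q = i + 1 then 1 else 0)))"
    using p q by (intro sum.cong refl) (simp add: matrix_unit_def of_nat_6_eq_iff del: of_nat_add of_nat_Suc)
  also have "\<dots> = (if p = q then ?x p p else 0)"
  proof (cases "p = q")
    case True
    have "p \<in> {1, 2, 3, 4, 5, 6}" using p by auto
    with True sum_diag_sl6[of x] show ?thesis
      by (auto simp: numeral_eq_Suc add_eq_0_iff)
  qed (auto intro!: sum.neutral)
  finally show "Rep_sl6 x $ a $ b = Rep_sl6 (?U + ?D) $ a $ b"
    using U by (simp add: Rep_sl6_simps p q)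
qed

lemma sl6_subspace_UNIV:
  assumes "sl6.subspace S" "\<And>i j. i \<in> {1..6} \<Longrightarrow> j \<in> {1..6} \<Longrightarrow> i \<noteq> j \<Longrightarrow> sl_unit i j \<in> S"
    "\<And>i. i \<in> {1..5} \<Longrightarrow> coroot i \<in> S"
  shows "x \<in> S"
proof -
  have units: "sl_unit i j \<in> S" if "i \<in> {1..6}" "j \<in> {1..6}" for i j
  proof (cases "i = j")
    case True
    have "sl_unit j j = 0" by (intro sl6_eqI) (simp add: sl_unit.rep_eq zero_sl6.rep_eq)
    with True assms(1) show ?thesis by (simp add: sl6.subspace_0)
  qed (use assms(2) that in auto)
  show ?thesis
    by (subst sl6_decomposition[of x])
      (intro sl6.subspace_add sl6.subspace_sum sl6.subspace_scale assms(1,3) units)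
qed

definition annihilated :: "vac_module \<Rightarrow> int \<Rightarrow> sl6 set" where
  "annihilated v m = {x. mode x m \<odot> v = 0}"

lemma subspace_annihilated: "sl6.subspace (annihilated v m)"
  unfolding sl6.subspace_def
  by (auto simp: annihilated_def mode_zero mode_add mode_scale act_zero_left act_add_left act_scale)

text \<open>The third hypothesis removes the central term, which acts by a scalar and need not kill
  \<open>v\<close>.\<close>

lemma annihilated_bracket:
  assumes "x \<in> annihilated v m" "y \<in> annihilated v n" "m + n = 0 \<Longrightarrow> m = 0"
  shows "sl_bracket x y \<in> annihilated v (m + n)"
proof -
  have "(mode x m * mode y n) \<odot> v = (mode y n * mode x m + mode (sl_bracket x y) (m + n)
      + (if m + n = 0 then of_int m * sl_form x y else 0) \<cdot> uea_gen central) \<odot> v"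
    by (simp only: mode_commute[of x m y n])
  then show ?thesis
    using assms
    by (cases "m + n = 0") (auto simp: annihilated_def act_add_left act_mult act_zero_right act_scale)
qed

lemma sl_bracket_coroot:
  assumes "i \<in> {1..5}"
  shows "sl_bracket (sl_unit i (i + 1)) (sl_unit (i + 1) i) = coroot i"
  using assms
  by (intro sl6_eqI) (simp add: sl_bracket.rep_eq Rep_sl_unit matrix_unit_mult coroot.rep_eq)

lemma ex_third_index:
  assumes "i \<in> {1..6::nat}" "j \<in> {1..6}"
  obtains l where "l \<in> {1..6}" "l \<noteq> i" "l \<noteq> j"
proof -
  have "card {i, j} < card {1..6::nat}" by (simp add: card_insert_if)
  then have "\<not> {1..6} \<subseteq> {i, j}" using card_mono[of "{i, j}" "{1..6}"] by auto
  then show ?thesis using that by blast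
qed

lemma annihilated_all:
  assumes simple: "\<And>i. i \<in> {1..5} \<Longrightarrow> sl_unit i (i + 1) \<in> annihilated v 0"
    and theta: "sl_unit 6 1 \<in> annihilated v 1"
  shows "sl_nplus \<subseteq> annihilated v 0" "m \<ge> 1 \<Longrightarrow> x \<in> annihilated v m"
proof -
  have upper: "sl_unit i j \<in> annihilated v 0" if "1 \<le> i" "i < j" "j \<le> 6" for i j
    using that(2,3)
  proof (induction j)
    case (Suc j)
    show ?case
    proof (cases "i = j")
      case False
      with Suc have "sl_bracket (sl_unit i j) (sl_unit j (j + 1)) \<in> annihilated v (0 + 0)"
        using that(1) by (intro annihilated_bracket simple) auto
      moreover have "sl_bracket (sl_unit i j) (sl_unit j (j + 1)) = sl_unit i (j + 1)"
        using Suc that(1) False by (intro sl_bracket_unit_unit) auto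
      ultimately show ?thesis by simp
    qed (use simple[of j] Suc that(1) in auto)
  qed simp
  then show "sl_nplus \<subseteq> annihilated v 0"
    unfolding sl_nplus_def by (intro sl6.span_minimal subspace_annihilated) auto
  have comp: "sl_unit i j \<in> annihilated v (a + b)"
    if "sl_unit i l \<in> annihilated v a" "sl_unit l j \<in> annihilated v b" "a + b > 0"
      "i \<in> {1..6}" "j \<in> {1..6}" "l \<in> {1..6}" "i \<noteq> j" "i \<noteq> l" "l \<noteq> j" for i j l a b
    using annihilated_bracket[OF that(1,2)] that sl_bracket_unit_unit[of i l j] by auto
  \<comment> \<open>From \<open>E_61(1)\<close>, bracketing on the right with \<open>E_1j(0)\<close>
    fills row 6 up to column 5; bracketing on the left with \<open>E_i6(0)\<close> then fills the
    other rows. Column 6 follows through a third index, and the coroots from opposite simple root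
    vectors.\<close>
  have row: "sl_unit 6 j \<in> annihilated v 1" if "j \<in> {1..5}" for j
    using comp[of 6 1 1 j 0] theta upper[of 1 j] that by (cases "j = 1") auto
  have block: "sl_unit i j \<in> annihilated v 1" if "i \<in> {1..6}" "j \<in> {1..5}" "i \<noteq> j" for i j
    using comp[of i 6 0 j 1] row upper[of i 6] that by (cases "i = 6") auto
  have units: "sl_unit i j \<in> annihilated v 1" if ij: "i \<in> {1..6}" "j \<in> {1..6}" "i \<noteq> j" for i j
  proof (cases "j = 6")
    case True
    obtain l where "l \<in> {1..6}" "l \<noteq> i" "l \<noteq> j" using ij(1,2) by (rule ex_third_index)
    then show ?thesis
      using comp[of i l 1 j 0] block[of i l] upper[of l j] ij True by auto
  qed (use block ij in auto)
  have one: "x \<in> annihilated v 1" for x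
  proof (rule sl6_subspace_UNIV[OF subspace_annihilated units])
    fix i assume i: "i \<in> {1..5::nat}"
    show "coroot i \<in> annihilated v 1"
      using annihilated_bracket[of "sl_unit i (i + 1)" v 0 "sl_unit (i + 1) i" 1]
        simple[of i] units[of "i + 1" i] i sl_bracket_coroot[of i] by auto
  qed
  show "x \<in> annihilated v m" if "m \<ge> 1"
    using that
  proof (induction m arbitrary: x rule: int_ge_induct)
    case (step m)
    show ?case
    proof (rule sl6_subspace_UNIV[OF subspace_annihilated])
      fix i j assume ij: "i \<in> {1..6::nat}" "j \<in> {1..6}" "i \<noteq> j"
      obtain l where "l \<in> {1..6}" "l \<noteq> i" "l \<noteq> j" using ij(1,2) by (rule ex_third_index)
      then show "sl_unit i j \<in> annihilated v (m + 1)"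
        using comp[of i l m j 1] step one ij by auto
    next
      fix i assume i: "i \<in> {1..5::nat}"
      show "coroot i \<in> annihilated v (m + 1)"
        using annihilated_bracket[of "sl_unit i (i + 1)" v m "sl_unit (i + 1) i" 1] step one
          i sl_bracket_coroot[of i] by auto
    qed
  qed (rule one)
qed

text \<open>Coroots are included: for \<open>i = j\<close> the eigenvalue is zero.\<close>

lemma sl_bracket_cartan:
  assumes "x \<in> sl_cartan" "valid i j"
  shows "sl_bracket x (sl_letter i j) =
    sl_scale (Rep_sl6 x $ of_nat (nat i) $ of_nat (nat i) - Rep_sl6 x $ of_nat (nat j) $ of_nat (nat j)) (sl_letter i j)"
proof (rule sl6_eqI)
  fix a b :: 6
  let ?X = "Rep_sl6 x" and ?A = "Rep_sl6 (sl_letter i j)"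
  have off: "?X $ c $ d = 0" if "c \<noteq> d" for c d
    using assms(1) that by (simp add: sl_cartan_def)
  have "(?X ** ?A) $ a $ b = (\<Sum>c\<in>UNIV. if c = a then ?X $ a $ a * ?A $ a $ b else 0)"
    unfolding matrix_matrix_mult_def by (simp only: vec_lambda_beta) (rule sum.cong[OF refl], auto simp: off)
  moreover have "(?A ** ?X) $ a $ b = (\<Sum>c\<in>UNIV. if c = b then ?A $ a $ b * ?X $ b $ b else 0)"
    unfolding matrix_matrix_mult_def by (simp only: vec_lambda_beta) (rule sum.cong[OF refl], auto simp: off)
  ultimately have "Rep_sl6 (sl_bracket x (sl_letter i j)) $ a $ b = (?X $ a $ a - ?X $ b $ b) * ?A $ a $ b"
    by (simp add: sl_bracket.rep_eq sum.delta algebra_simps)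
  then show "Rep_sl6 (sl_bracket x (sl_letter i j)) $ a $ b = Rep_sl6 (sl_scale (Rep_sl6 x $ of_nat (nat i) $ of_nat (nat i)
      - Rep_sl6 x $ of_nat (nat j) $ of_nat (nat j)) (sl_letter i j)) $ a $ b"
    by (auto simp: Rep_sl6_simps Rep_sl_letter[OF assms(2)] matrix_unit_def)
qed

section \<open>Collecting like words\<close>

text \<open>
  Words are collected in a search tree by an arbitrary hash. Outcomes of comparisons are passed as
  arguments to auxiliary functions, since a conditional would make the simplifier traverse the
  whole tree again after each step.
\<close>

datatype tree = Tip | Node tree int "letter list" int tree

fun word_key :: "letter list \<Rightarrow> int" where
  "word_key [] = 0"
| "word_key ((i, j, m) # w) = (word_key w * 37 + 83 * i + 17 * j - 5 * m) mod 257"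

function tree_insert :: "int \<Rightarrow> letter list \<Rightarrow> int \<Rightarrow> tree \<Rightarrow> tree"
  and insert_cmp :: "bool \<Rightarrow> bool \<Rightarrow> int \<Rightarrow> letter list \<Rightarrow> int \<Rightarrow> tree \<Rightarrow> int \<Rightarrow> letter list \<Rightarrow> int \<Rightarrow> tree \<Rightarrow> tree"
  and insert_eq :: "bool \<Rightarrow> int \<Rightarrow> letter list \<Rightarrow> int \<Rightarrow> tree \<Rightarrow> int \<Rightarrow> letter list \<Rightarrow> int \<Rightarrow> tree \<Rightarrow> tree"
where
  "tree_insert k w a Tip = Node Tip k w a Tip"
| "tree_insert k w a (Node l k' u s r) = insert_cmp (k = k') (k < k') k w a l k' u s r"
| "insert_cmp True b k w a l k' u s r = insert_eq (w = u) k w a l k' u s r"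
| "insert_cmp False True k w a l k' u s r = Node (tree_insert k w a l) k' u s r"
| "insert_cmp False False k w a l k' u s r = Node l k' u s (tree_insert k w a r)"
| "insert_eq True k w a l k' u s r = Node l k' u (s + a) r"
| "insert_eq False k w a l k' u s r = Node l k' u s (tree_insert k w a r)"
  by pat_completeness auto
termination
  \<comment> \<open>A node weighs at least 3 more than its two subtrees together, which leaves room
    for the two intermediate comparison calls.\<close>
  by (relation "measures [case_sum (\<lambda>(k, w, a, t). 3 * size t)
      (case_sum (\<lambda>(b, c, k, w, a, l, k', u, s, r). Suc (Suc (3 * (size l + size r))))
        (\<lambda>(c, k, w, a, l, k', u, s, r). Suc (3 * (size l + size r))))]") auto

fun tree_vec :: "tree \<Rightarrow> vac_module" where
  "tree_vec Tip = 0"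
| "tree_vec (Node l k w s r) = vac_scale (of_int s) (word w \<odot> vacuum) + (tree_vec l + tree_vec r)"

text \<open>The value sums over all nodes, wherever they are placed, and entries are merged only
  after the words themselves are found equal. Collisions of the hash are therefore harmless.\<close>

lemma tree_vec_insert:
  "tree_vec (tree_insert k w a t) = vac_scale (of_int a) (word w \<odot> vacuum) + tree_vec t"
  "b = (k = k') \<Longrightarrow>
     tree_vec (insert_cmp b c k w a l k' u s r) = vac_scale (of_int a) (word w \<odot> vacuum) + tree_vec (Node l k' u s r)"
  "d = (w = u) \<Longrightarrow>
     tree_vec (insert_eq d k w a l k' u s r) = vac_scale (of_int a) (word w \<odot> vacuum) + tree_vec (Node l k' u s r)"
  by (induction k w a t and b c k w a l k' u s r and d k w a l k' u s r rule: tree_insert_insert_cmp_insert_eq.induct)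
    (simp_all add: vac.scale_left_distrib algebra_simps)

fun add_comb :: "int \<Rightarrow> comb \<Rightarrow> tree \<Rightarrow> tree" where
  "add_comb c [] t = t"
| "add_comb c ((a, w) # p) t = add_comb c p (tree_insert (word_key w) w (c * a) t)"

lemma tree_vec_add_comb: "tree_vec (add_comb c p t) = vac_scale (of_int c) (comb_vec p) + tree_vec t"
  by (induction c p t rule: add_comb.induct)
    (simp_all add: comb_vec_simps tree_vec_insert vac.scale_right_distrib algebra_simps)

fun act_tree :: "letter \<Rightarrow> comb \<Rightarrow> tree" where
  "act_tree X [] = Tip"
| "act_tree X ((c, w) # p) = add_comb c (apply_letter 20 X w) (act_tree X p)"

lemma tree_vec_act_tree: "tree_vec (act_tree X p) = letter X \<odot> comb_vec p"
  by (induction X p rule: act_tree.induct)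
    (simp_all add: comb_vec_simps tree_vec_add_comb comb_vec_apply_letter act_zero_right act_add_right act_scale_right)

fun all_zero :: "tree \<Rightarrow> bool" where
  "all_zero Tip = True"
| "all_zero (Node l k w s r) = (s = 0 \<and> all_zero l \<and> all_zero r)"

lemma all_zero_tree_vec: "all_zero t \<Longrightarrow> tree_vec t = 0"
  by (induction t) auto

definition kills :: "comb \<Rightarrow> letter \<Rightarrow> bool" where
  "kills p X = all_zero (act_tree X p)"

lemma killsD: "kills p X \<Longrightarrow> letter X \<odot> comb_vec p = 0"
  unfolding kills_def by (metis all_zero_tree_vec tree_vec_act_tree)

text \<open>Inserting a letter into a sorted word gives sorted words again, as long as the bound on
  the recursion suffices. Starting from sorted words lets equal terms meet in the tree and
  cancel.\<close>

fun normal_form :: "letter list \<Rightarrow> comb" where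
  "normal_form [] = [(1, [])]"
| "normal_form (X # w) = extend (apply_letter 20 X) (normal_form w)"

lemma comb_vec_normal_form: "comb_vec (normal_form w) = word w \<odot> vacuum"
  by (induction w) (simp_all add: comb_vec_simps word_simps comb_vec_extend[OF comb_vec_apply_letter] act_mult)

lemma comb_vec_extend_normal_form: "comb_vec (extend normal_form p) = comb_vec p"
  using comb_vec_extend[of normal_form 1 p] by (simp add: comb_vec_normal_form act_one)

section \<open>Translation of the explicit vector into lists with rational coefficients\<close>

text \<open>Coefficients \<open>(a, b)\<close> stand for \<open>a / b\<close> and are never reduced.\<close>

type_synonym qcomb = "((int \<times> int) \<times> letter list) list"

definition qcomb_uea :: "qcomb \<Rightarrow> uea" where
  "qcomb_uea p = (\<Sum>((a, b), w)\<leftarrow>p. (of_int a / of_int b) \<cdot> word w)"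

lemma qcomb_uea_simps: "qcomb_uea [] = 0" "qcomb_uea (((a, b), w) # p) = (of_int a / of_int b) \<cdot> word w + qcomb_uea p"
  by (simp_all add: qcomb_uea_def)

definition qcomb_scale :: "int \<Rightarrow> int \<Rightarrow> qcomb \<Rightarrow> qcomb" where
  "qcomb_scale a b p = map (\<lambda>((c, d), w). ((a * c, b * d), w)) p"

definition qcomb_mult :: "qcomb \<Rightarrow> qcomb \<Rightarrow> qcomb" where
  "qcomb_mult p q = concat (map (\<lambda>((a, b), u). map (\<lambda>((c, d), w). ((a * c, b * d), u @ w)) q) p)"

lemma qcomb_uea_append: "qcomb_uea (p @ q) = qcomb_uea p + qcomb_uea q"
  by (simp add: qcomb_uea_def)

lemma qcomb_uea_qcomb_scale: "qcomb_uea (qcomb_scale a b p) = (of_int a / of_int b) \<cdot> qcomb_uea p"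
  by (induction p) (auto simp: qcomb_scale_def qcomb_uea_simps uea_scale_add uea_scale_scale)

lemma qcomb_uea_qcomb_mult: "qcomb_uea (qcomb_mult p q) = qcomb_uea p * qcomb_uea q"
proof -
  have "qcomb_uea (map (\<lambda>((c, d), w). ((a * c, b * d), u @ w)) q) = (of_int a / of_int b) \<cdot> word u * qcomb_uea q" for a b u
    by (induction q)
      (auto simp: qcomb_uea_simps word_simps distrib_left uea_scale_add uea_scale_scale uea_scale_mult_right mult.commute)
  then show ?thesis
    by (induction p)
      (auto simp: qcomb_mult_def qcomb_uea_simps qcomb_uea_append distrib_right uea_scale_mult_left)
qed

text \<open>The coefficient 1/2 undoes the doubling in \<open>letter\<close>.\<close>

lemma reify_mode:
  assumes "int i = i'" "int j = j'" "i' \<noteq> j'"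
  shows "mode (sl_unit i j) m = qcomb_uea [((1, 2), [(i', j', m)])]"
  using assms by (auto simp: qcomb_uea_simps word_simps letter_def sl_letter_def uea_scale_scale)

lemma reify_mode_coroot:
  assumes "int i = i'"
  shows "mode (coroot i) m = qcomb_uea [((1, 2), [(i', i', m)])]"
  using assms by (auto simp: qcomb_uea_simps word_simps letter_def sl_letter_def uea_scale_scale)

lemma reify_add: "u = qcomb_uea p \<Longrightarrow> w = qcomb_uea q \<Longrightarrow> u + w = qcomb_uea (p @ q)"
  by (simp add: qcomb_uea_append)

lemma reify_uminus: "u = qcomb_uea p \<Longrightarrow> - u = qcomb_uea (qcomb_scale (- 1) 1 p)"
  by (simp add: qcomb_uea_qcomb_scale)

lemma reify_diff: "u = qcomb_uea p \<Longrightarrow> w = qcomb_uea q \<Longrightarrow> u - w = qcomb_uea (p @ qcomb_scale (- 1) 1 q)"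
  by (simp add: qcomb_uea_append qcomb_uea_qcomb_scale)

lemma reify_mult: "u = qcomb_uea p \<Longrightarrow> w = qcomb_uea q \<Longrightarrow> u * w = qcomb_uea (qcomb_mult p q)"
  by (simp add: qcomb_uea_qcomb_mult)

lemma reify_square: "u = qcomb_uea p \<Longrightarrow> u ^ 2 = qcomb_uea (qcomb_mult p p)"
  by (simp add: qcomb_uea_qcomb_mult power2_eq_square)

lemma reify_scale_div:
  "c = of_int a \<Longrightarrow> d = of_int b \<Longrightarrow> u = qcomb_uea p \<Longrightarrow> (c / d) \<cdot> u = qcomb_uea (qcomb_scale a b p)"
  by (simp add: qcomb_uea_qcomb_scale)

lemma reify_scale: "c = of_int a \<Longrightarrow> u = qcomb_uea p \<Longrightarrow> c \<cdot> u = qcomb_uea (qcomb_scale a 1 p)"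
  by (simp add: qcomb_uea_qcomb_scale)

lemma reify_int:
  "int 1 = 1" "int (numeral n) = numeral n" "(numeral n :: complex) = of_int (numeral n)"
  "(- numeral n :: complex) = of_int (- numeral n)" "(1 :: complex) = of_int 1" "(- 1 :: complex) = of_int (- 1)"
  by simp_all

lemmas reify = reify_add reify_uminus reify_diff reify_mult reify_square reify_scale_div reify_scale
  reify_mode reify_mode_coroot reify_int

text \<open>All denominators that occur divide 960; powers of 2 stem from the factor in \<^const>\<open>letter\<close>.\<close>

fun denoms :: "qcomb \<Rightarrow> bool" where
  "denoms [] = True"
| "denoms (((a, b), w) # p) = (b \<noteq> 0 \<and> 960 mod b = 0 \<and> denoms p)"

fun clear_denoms :: "qcomb \<Rightarrow> comb" where
  "clear_denoms [] = []"
| "clear_denoms (((a, b), w) # p) = (a * (960 div b), w) # clear_denoms p"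

lemma comb_vec_clear_denoms: "denoms p \<Longrightarrow> comb_vec (clear_denoms p) = vac_scale 960 (qcomb_uea p \<odot> vacuum)"
proof (induction p rule: denoms.induct)
  case (2 a b w p)
  then have "960 = b * (960 div b)" "b \<noteq> 0" by auto
  then have "(960 :: complex) = of_int b * of_int (960 div b)"
    by (metis of_int_mult of_int_numeral)
  then have "(of_int (a * (960 div b)) :: complex) = 960 * (of_int a / of_int b)"
    using \<open>b \<noteq> 0\<close> by (simp add: field_simps)
  with 2 show ?case
    by (simp only: clear_denoms.simps comb_vec_simps qcomb_uea_simps act_add_left act_scale vac.scale_right_distrib
        vac.scale_scale denoms.simps simp_thms)
qed (simp add: comb_vec_simps qcomb_uea_simps act_zero_left)

text \<open>Twice the character, in keeping with the doubled letters; the four terms pair with the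
  summands of \<open>whit_elt\<close>.\<close>

definition whit_letter :: "letter \<Rightarrow> int" where
  "whit_letter X = (case X of (i, j, m) \<Rightarrow>
     if m = - 1 then 2 * (letter_form 3 1 i j + letter_form 4 2 i j + letter_form 5 3 i j + letter_form 6 4 i j) else 0)"

fun whit_comb :: "comb \<Rightarrow> int" where
  "whit_comb [] = 0"
| "whit_comb ((c, w) # p) = c * prod_list (map whit_letter w) + whit_comb p"

fun degree_sum :: "letter list \<Rightarrow> int" where
  "degree_sum [] = 0" | "degree_sum ((i, j, m) # w) = m + degree_sum w"

fun weight_sum :: "int \<Rightarrow> letter list \<Rightarrow> int" where
  "weight_sum r [] = 0" | "weight_sum r ((i, j, m) # w) = kronecker i r - kronecker j r + weight_sum r w"

text \<open>With \<open>\<epsilon>r\<close> the r-th diagonal entry,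
  \<open>\<omega>2 + \<omega>4\<close> is
  \<open>2 \<epsilon>1 + 2 \<epsilon>2 + \<epsilon>3 + \<epsilon>4\<close>. Subtracting the trace
  gives the balanced vector of coordinates tested here, as a sum of roots must be.\<close>

definition ok_word :: "letter list \<Rightarrow> bool" where
  "ok_word w \<longleftrightarrow> list_all (\<lambda>(i, j, m). valid i j \<and> m < 0) w \<and> degree_sum w = - 4
     \<and> map (\<lambda>r. weight_sum r w) [1, 2, 3, 4, 5, 6] = [1, 1, 0, 0, - 1, - 1]"

definition checked :: "comb \<Rightarrow> bool" where
  "checked p \<longleftrightarrow> list_all (\<lambda>(c, w). ok_word w) p \<and> whit_comb p \<noteq> 0 \<and>
     list_all (kills p) [(1, 2, 0), (2, 3, 0), (3, 4, 0), (4, 5, 0), (5, 6, 0), (6, 1, 1)]"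

text \<open>All explicit computation is concentrated here. The list of terms stays behind the
  quantifier, as the rest of the argument uses only the stated properties.\<close>

lemma reified_elements: "\<exists>p. A_elt + B_elt + C_elt = qcomb_uea p \<and> denoms p \<and> checked (extend normal_form (clear_denoms p))"
  unfolding A_elt_def B_elt_def C_elt_def
  apply (rule exI, rule conjI)
   \<comment> \<open>The unknown list is assembled along the syntax of the vector. Quotients are
     tried before plain scalars, so numerator and denominator are recorded as separate
     integers.\<close>
   apply ((rule reify | simp; fail)+)[1]
  apply (rule conjI)
  apply code_simp
  apply code_simp
  done

section \<open>Weights and nonvanishing\<close>

definition diag :: "sl6 \<Rightarrow> int \<Rightarrow> complex" where
  "diag x r = Rep_sl6 x $ of_nat (nat r) $ of_nat (nat r)"

lemma cartan_letter_commute: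
  assumes "x \<in> sl_cartan" "valid i j" "X = affine_scale a central + affine_scale b derivation + loop x 0"
  shows "uea_gen X * letter (i, j, m) =
    letter (i, j, m) * uea_gen X + (b * of_int m + (diag x i - diag x j)) \<cdot> letter (i, j, m)"
proof -
  have "affine_bracket X (loop (sl_letter i j) m) =
      affine_scale (b * of_int m + (diag x i - diag x j)) (loop (sl_letter i j) m)"
    using sl_bracket_cartan[OF assms(1,2)]
    by (simp add: assms(3) affine_bracket_linear affine_bracket_gens affine_scale_add_left
        loop_scale diag_def)
  then show ?thesis
    using uea_gen_commute[of X "loop (sl_letter i j) m"]
    by (simp add: letter_def mode_def uea_gen_scale uea_scale_mult_left uea_scale_mult_right
        uea_scale_add uea_scale_scale mult.commute)
qed

lemma cartan_word_commute:
  assumes "x \<in> sl_cartan" "X = affine_scale a central + affine_scale b derivation + loop x 0"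
    and "list_all (\<lambda>(i, j, m). valid i j \<and> m < 0) w"
  shows "uea_gen X * word w = word w * uea_gen X
    + (b * of_int (degree_sum w) + (\<Sum>r\<in>{1..6}. of_int (weight_sum r w) * diag x r)) \<cdot> word w"
  using assms(3)
proof (induction w)
  case (Cons l w)
  obtain i j m where l: "l = (i, j, m)" by (cases l)
  have v: "valid i j" and w: "list_all (\<lambda>(i, j, m). valid i j \<and> m < 0) w" using Cons.prems by (auto simp: l)
  \<comment> \<open>Writing a diagonal entry with Kronecker coefficients lets the weights of the
    letters add up coordinatewise.\<close>
  have d: "diag x k = (\<Sum>r\<in>{1..6}. of_int (kronecker k r) * diag x r)" if "k \<in> {1..6}" for k
  proof -
    have "(\<Sum>r\<in>{1..6}. of_int (kronecker k r) * diag x r) = (\<Sum>r\<in>{1..6}. if r = k then diag x k else 0)"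
      by (rule sum.cong) (auto simp: kronecker_def)
    then show ?thesis using that by (simp add: sum.delta)
  qed
  let ?c = "b * of_int m + (diag x i - diag x j)"
    and ?d = "b * of_int (degree_sum w) + (\<Sum>r\<in>{1..6}. of_int (weight_sum r w) * diag x r)"
  have "b * of_int (degree_sum (l # w)) + (\<Sum>r\<in>{1..6}. of_int (weight_sum r (l # w)) * diag x r) = ?c + ?d"
    using v d[of i] d[of j]
    by (simp add: l valid_def distrib_left distrib_right left_diff_distrib sum.distrib sum_subtractf)
  moreover have "uea_gen X * word (l # w) = word (l # w) * uea_gen X + (?c + ?d) \<cdot> word (l # w)"
  proof -
    have "uea_gen X * word (l # w) = (uea_gen X * letter l) * word w" by (simp add: word_simps mult.assoc)
    also have "\<dots> = letter l * (uea_gen X * word w) + ?c \<cdot> word (l # w)"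
      unfolding l cartan_letter_commute[OF assms(1) v assms(2)]
      by (simp add: distrib_right word_simps mult.assoc uea_scale_mult_left)
    also have "\<dots> = word (l # w) * uea_gen X + (?c + ?d) \<cdot> word (l # w)"
      unfolding Cons.IH[OF w]
      by (simp add: distrib_left word_simps mult.assoc uea_scale_mult_right uea_scale_add_left add_ac)
    finally show ?thesis .
  qed
  ultimately show ?case by simp
qed (simp add: word_simps)

definition target_weight :: "affine \<Rightarrow> complex" where
  "target_weight X = - 7/2 * Lambda0 X - 4 * delta X + omega 2 X + omega 4 X"

lemma target_weight_cartan:
  assumes "X = affine_scale a central + affine_scale b derivation + loop x 0"
  shows "target_weight X = level * a - 4 * b + (diag x 1 + diag x 2 - diag x 5 - diag x 6)"
proof -
  have "Poly_Mapping.lookup (fst X) 0 = x"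
    by (simp add: assms central_def derivation_def loop_def lookup_add)
  moreover have "Lambda0 X = a" "delta X = b"
    by (simp_all add: assms central_def derivation_def loop_def Lambda0_def delta_def)
  \<comment> \<open>Vanishing trace eliminates \<open>diag x 3\<close>, after which
    \<open>diag x 4\<close> cancels in the sum of the two fundamental weights.\<close>
  moreover have "diag x 1 + diag x 2 + diag x 3 + diag x 4 + diag x 5 + diag x 6 = 0"
    using sum_diag_sl6[of x] by (simp add: diag_def numeral_eq_Suc)
  then have "diag x 3 = - (diag x 1 + diag x 2 + diag x 4 + diag x 5 + diag x 6)"
    by (simp only: eq_neg_iff_add_eq_0 add_ac)
  moreover have "(\<Sum>j = 1..2. Rep_sl6 x $ of_nat j $ of_nat j) = diag x 1 + diag x 2"
    "(\<Sum>j = 1..4. Rep_sl6 x $ of_nat j $ of_nat j) = diag x 1 + diag x 2 + diag x 3 + diag x 4"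
    by (simp_all add: diag_def numeral_eq_Suc)
  ultimately show ?thesis
    by (simp add: target_weight_def omega_def level_def)
qed

lemma ok_word_weight:
  assumes "ok_word w" "X \<in> affine_cartan"
  shows "uea_gen X \<odot> word w \<odot> vacuum = vac_scale (target_weight X) (word w \<odot> vacuum)"
proof -
  obtain a b x where x: "x \<in> sl_cartan"
    and X: "X = affine_scale a central + affine_scale b derivation + loop x 0"
    using assms(2) by (auto simp: affine_cartan_def)
  have six: "{1..6} = {1, 2, 3, 4, 5, 6::int}" by auto
  have ws: "(\<Sum>r\<in>{1..6}. of_int (weight_sum r w) * diag x r) = diag x 1 + diag x 2 - diag x 5 - diag x 6"
    using assms(1) by (simp add: six ok_word_def)
  have X0: "uea_gen X \<odot> vacuum = vac_scale (level * a) vacuum"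
    by (simp add: X uea_gen_add uea_gen_scale act_add_left act_scale central_vacuum derivation_vacuum
        mode_def[symmetric] nonneg_mode_vacuum mult.commute)
  have all: "list_all (\<lambda>(i, j, m). valid i j \<and> m < 0) w" and deg: "degree_sum w = - 4"
    using assms(1) by (simp_all add: ok_word_def)
  have "uea_gen X \<odot> word w \<odot> vacuum = word w \<odot> uea_gen X \<odot> vacuum
      + vac_scale (b * of_int (- 4) + (diag x 1 + diag x 2 - diag x 5 - diag x 6)) (word w \<odot> vacuum)"
    by (simp only: act_mult[symmetric] cartan_word_commute[OF x X all] ws deg act_add_left act_scale)
  also have "\<dots> = vac_scale (level * a + (b * of_int (- 4) + (diag x 1 + diag x 2 - diag x 5 - diag x 6))) (word w \<odot> vacuum)"
    by (simp only: X0 act_scale_right vac.scale_left_distrib)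
  finally show ?thesis by (simp add: target_weight_cartan[OF X] algebra_simps)
qed

lemma comb_vec_weight:
  assumes "list_all (\<lambda>(c, w). ok_word w) p" "X \<in> affine_cartan"
  shows "uea_gen X \<odot> comb_vec p = vac_scale (target_weight X) (comb_vec p)"
  using assms(1)
  by (induction p)
    (auto simp: comb_vec_simps act_zero_right act_add_right act_scale_right ok_word_weight[OF _ assms(2)]
      vac.scale_right_distrib vac.scale_left_commute)

text \<open>The functional is defined on the enveloping algebra, so \<open>comb_vec p\<close> needs
  a representative there.\<close>

definition comb_uea :: "comb \<Rightarrow> uea" where
  "comb_uea p = (\<Sum>(c, w)\<leftarrow>p. of_int c \<cdot> word w)"

lemma comb_uea_vacuum: "comb_uea p \<odot> vacuum = comb_vec p"
  by (simp add: comb_uea_def comb_vec_def act_sum_list act_scale case_prod_unfold)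

lemma whit_char_letter:
  assumes "valid i j"
  shows "2 * whit_char (loop (sl_letter i j) m) = of_int (whit_letter (i, j, m))"
proof -
  have whit_comb: "whit_elt = sl_letter 3 1 + sl_letter 4 2 + sl_letter 5 3 + sl_letter 6 4"
    by (simp add: whit_elt_def sl_letter_def)
  show ?thesis
    using assms sl_form_letters[of 3 1 i j] sl_form_letters[of 4 2 i j]
      sl_form_letters[of 5 3 i j] sl_form_letters[of 6 4 i j]
    by (simp add: whit_comb whit_char_loop whit_letter_def sl_form_add_left valid_def[of 3] valid_def[of 4] valid_def[of 5] valid_def[of 6])
qed

lemma whit_uea_letters:
  assumes "list_all (\<lambda>(i, j, m). valid i j \<and> m < 0) w"
  shows "whit_uea (word w) = of_int (prod_list (map whit_letter w))"
proof -
  let ?l = "map (\<lambda>(i, j, m). (sl_letter i j, m)) w"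
  have "word w = 2 ^ length w \<cdot> prod_list (map (\<lambda>(x, m). mode x m) ?l)"
    by (induction w)
      (auto simp: word_simps letter_def uea_scale_mult_left uea_scale_mult_right uea_scale_scale)
  moreover have "whit_uea (prod_list (map (\<lambda>(x, m). mode x m) ?l)) = (\<Prod>(x, m)\<leftarrow>?l. whit_char (loop x m))"
    by (rule whit_uea_modes) (use assms in \<open>auto simp: list_all_iff\<close>)
  moreover have "2 ^ length w * (\<Prod>(x, m)\<leftarrow>?l. whit_char (loop x m)) = of_int (prod_list (map whit_letter w))"
    using assms
  proof (induction w)
    case (Cons l w)
    obtain i j m where l: "l = (i, j, m)" by (cases l)
    then show ?case using Cons whit_char_letter[of i j m] by (simp add: mult.assoc mult.left_commute)
  qed simp
  ultimately show ?thesis by (simp add: whit_uea_scale)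
qed

lemma whit_uea_comb_uea:
  assumes "list_all (\<lambda>(c, w). ok_word w) p"
  shows "whit_uea (comb_uea p) = of_int (whit_comb p)"
  using assms
proof (induction p)
  case Nil
  show ?case using whit_uea_scale[of 0 0] by (simp add: comb_uea_def)
next
  case (Cons cw p)
  then show ?case
    by (cases cw) (auto simp: comb_uea_def whit_uea_add whit_uea_scale whit_uea_letters ok_word_def)
qed

lemma comb_vec_nonzero:
  assumes "list_all (\<lambda>(c, w). ok_word w) p" "whit_comb p \<noteq> 0"
  shows "comb_vec p \<noteq> 0"
proof
  assume "comb_vec p = 0"
  then have "comb_uea p \<in> vacuum_ideal level"
    by (simp add: comb_uea_vacuum[symmetric] act_vacuum abs_vac_eq_0_iff)
  from whit_uea_vacuum_ideal[OF this, of 1] show False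
    using assms by (simp add: whit_uea_comb_uea)
qed

theorem theorem4p1:
  shows "singular_vector ((A_elt + B_elt + C_elt) \<odot> vacuum) \<and>
    (A_elt + B_elt + C_elt) \<odot> vacuum
      \<in> weight_space (\<lambda>X. - 7/2 * Lambda0 X - 4 * delta X + omega 2 X + omega 4 X)"
proof -
  let ?v = "(A_elt + B_elt + C_elt) \<odot> vacuum"
  obtain q where q: "A_elt + B_elt + C_elt = qcomb_uea q" "denoms q" "checked (extend normal_form (clear_denoms q))"
    using reified_elements by blast
  \<comment> \<open>The checked list represents 960 times the vector; the factor is invertible and
    affects neither weight, annihilation nor nonvanishing.\<close>
  define p where "p = extend normal_form (clear_denoms q)"
  have p: "comb_vec p = vac_scale 960 ?v"
    by (simp add: p_def comb_vec_extend_normal_form comb_vec_clear_denoms q)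
  then have v: "?v = vac_scale (1 / 960) (comb_vec p)" by simp
  have ok: "list_all (\<lambda>(c, w). ok_word w) p" "whit_comb p \<noteq> 0" and
    ann: "kills p (1, 2, 0)" "kills p (2, 3, 0)" "kills p (3, 4, 0)" "kills p (4, 5, 0)"
      "kills p (5, 6, 0)" "kills p (6, 1, 1)"
    using q(3) by (auto simp: checked_def p_def)
  have weight: "?v \<in> weight_space target_weight"
    unfolding weight_space_def v using comb_vec_weight[OF ok(1)]
    by (auto simp: act_scale_right vac.scale_left_commute)
  have nonzero: "?v \<noteq> 0"
    using comb_vec_nonzero[OF ok] p by auto
  have mode0: "mode (sl_letter i j) m \<odot> ?v = 0" if "kills p (i, j, m)" for i j m
    using killsD[OF that] by (simp add: letter_act p act_scale_right)
  have simple: "sl_unit i (i + 1) \<in> annihilated ?v 0" if "i \<in> {1..5}" for i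
  proof -
    have "sl_unit 1 2 \<in> annihilated ?v 0" "sl_unit 2 3 \<in> annihilated ?v 0"
      "sl_unit 3 4 \<in> annihilated ?v 0" "sl_unit 4 5 \<in> annihilated ?v 0" "sl_unit 5 6 \<in> annihilated ?v 0"
      using ann(1-5)[THEN mode0] by (simp_all add: annihilated_def sl_letter_def)
    moreover have "i = 1 \<or> i = 2 \<or> i = 3 \<or> i = 4 \<or> i = 5" using that by auto
    ultimately show ?thesis by (elim disjE) (simp_all del: One_nat_def)
  qed
  have theta: "sl_unit 6 1 \<in> annihilated ?v 1"
    using ann(6)[THEN mode0] by (simp add: annihilated_def sl_letter_def)
  note all = annihilated_all[of ?v, OF simple theta]
  have "singular_vector ?v"
    unfolding singular_vector_def
  proof (intro conjI ballI allI impI)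
    show "?v \<noteq> 0" by (rule nonzero)
    show "\<exists>l. ?v \<in> weight_space l" using weight by blast
    show "mode x 0 \<odot> ?v = 0" if "x \<in> sl_nplus" for x
      using all(1) that by (auto simp: annihilated_def)
    show "mode x m \<odot> ?v = 0" if "1 \<le> m" for x m
      using all(2)[OF _ that] by (simp add: annihilated_def)
  qed
  moreover have "target_weight = (\<lambda>X. - 7/2 * Lambda0 X - 4 * delta X + omega 2 X + omega 4 X)"
    by (simp add: target_weight_def fun_eq_iff)
  ultimately show ?thesis using weight by simp
qed

end
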